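(* Let $D\subset\mathbf R^2$ be a bounded domain, let $V\in L\log L(D)$ be real-valued, let $E\le0$ be a constant, and let $u\in W_0^{1,2}(D)$ be a nontrivial distributional solution of $$-\Delta u-Vu=Eu .$$ Then $$\frac{C_2|D|}{4\pi}\,\|V_+\|_{N_D}\ \ge\ 1,$$ where $C_2$ is the constant of the Moser–Trudinger inequality.
   Context: $W^{1,2}_0(D)$ is the closure of $C_0^\infty(D)$ with respect to $\|\nabla u\|_2$. $V_+=\max\{V,0\}$. $L\log L(D)$ is the set of measurable $f$ with $\int_D|f|(1+\log^+|f|)\,dx<\infty$. The Moser–Trudinger inequality is $$\int_D\Big(e^{4\pi(|u(x)|/\|\nabla u\|_2)^2}-1\Big)dx\le C_2|D|,\qquad u\in W^{1,2}_0(D),\ u\neq0,$$ where the constant $C_2$ does not depend on $u$ or $D$. Let $N(y)=y\log y-y+1$ for $y\ge1$ and $N(y)=0$ otherwise. For $f\in L\log L(D)$, $$\|f\|_{N_D}=\inf_{\lambda>0}\Big\{\lambda+\frac{\lambda}{C_2|D|}\int_DN\Big(\frac{|f(x)|}{\lambda}\Big)dx\Big\}.$$ Distributional solution means $\int_D\nabla u\cdot\nabla\psi\,dx=\int_D(V+E)u\psi\,dx$ for all $\psi\in C_0^\infty(D)$; nontrivial means not a.e. zero. *)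

theory Defs
  imports "HOL-Analysis.Analysis"
begin

text \<open>
  The plane is \<^typ>\<open>real^2\<close>. Functions on \<open>D\<close> are total functions whose values outside \<open>D\<close>
  are irrelevant; measurability and integrals refer to Lebesgue measure on \<open>D\<close>.
  Values are taken in a type of sort \<open>{real_normed_field, euclidean_space}\<close>, so that real- and
  complex-valued functions are both covered.
\<close>

definition bounded_domain :: "(real^2) set \<Rightarrow> bool" where
  "bounded_domain D \<longleftrightarrow> open D \<and> connected D \<and> D \<noteq> {} \<and> bounded D"

definition grad :: "(real^2 \<Rightarrow> 'a::real_normed_vector) \<Rightarrow> real^2 \<Rightarrow> 'a^2" where
  "grad f x = (\<chi> i. frechet_derivative f (at x) (axis i 1))"

primrec C_k :: "nat \<Rightarrow> (real^2 \<Rightarrow> 'a::real_normed_vector) \<Rightarrow> bool" where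
  "C_k 0 f \<longleftrightarrow> continuous_on UNIV f"
| "C_k (Suc k) f \<longleftrightarrow> (\<forall>x. f differentiable (at x)) \<and> (\<forall>i. C_k k (\<lambda>x. grad f x $ i))"

text \<open>The space \<open>C\<^sub>0\<^sup>\<infinity>(D)\<close>; its elements are extended by zero to the whole plane.\<close>

definition test_functions :: "(real^2) set \<Rightarrow> (real^2 \<Rightarrow> 'a::real_normed_vector) set" where
  "test_functions D =
     {\<psi>. (\<forall>k. C_k k \<psi>) \<and> compact (closure {x. \<psi> x \<noteq> 0}) \<and> closure {x. \<psi> x \<noteq> 0} \<subseteq> D}"

definition square_integrable :: "(real^2) set \<Rightarrow> (real^2 \<Rightarrow> 'a::euclidean_space) \<Rightarrow> bool" where
  "square_integrable D f \<longleftrightarrow>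
     f \<in> borel_measurable (lebesgue_on D) \<and> integrable (lebesgue_on D) (\<lambda>x. (norm (f x))\<^sup>2)"

definition norm_L2 :: "(real^2) set \<Rightarrow> (real^2 \<Rightarrow> 'a::euclidean_space) \<Rightarrow> real" where
  "norm_L2 D f = sqrt (\<integral>x. (norm (f x))\<^sup>2 \<partial>lebesgue_on D)"

definition locally_integrable :: "(real^2) set \<Rightarrow> (real^2 \<Rightarrow> 'a::euclidean_space) \<Rightarrow> bool" where
  "locally_integrable D f \<longleftrightarrow> (\<forall>K. compact K \<and> K \<subseteq> D \<longrightarrow> integrable (lebesgue_on K) f)"

text \<open>
  \<open>g\<close> is the distributional gradient of \<open>u\<close> on \<open>D\<close>. It is a relation because \<open>g\<close> is determined
  by \<open>u\<close> only almost everywhere.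
\<close>

definition has_weak_gradient ::
  "(real^2) set \<Rightarrow> (real^2 \<Rightarrow> 'a::{real_normed_field, euclidean_space}) \<Rightarrow> (real^2 \<Rightarrow> 'a^2) \<Rightarrow> bool"
where
  "has_weak_gradient D u g \<longleftrightarrow> locally_integrable D u \<and> locally_integrable D g \<and>
     (\<forall>\<psi> \<in> test_functions D. \<forall>i.
        (\<integral>x. u x * grad \<psi> x $ i \<partial>lebesgue_on D) = - (\<integral>x. g x $ i * \<psi> x \<partial>lebesgue_on D))"

text \<open>
  The closure of \<open>C\<^sub>0\<^sup>\<infinity>(D)\<close> in the norm \<open>\<parallel>\<nabla>u\<parallel>\<^sub>2\<close>. On a bounded domain Poincare's inequality makes
  a sequence of test functions that is Cauchy in this norm converge also in \<open>L\<^sup>2(D)\<close>. Convergence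
  in \<open>L\<^sup>2(D)\<close> is part of the definition because it is what identifies the limit as a function:
  convergence of the gradients alone would determine \<open>u\<close> only up to a constant.
\<close>

definition W12_0 :: "(real^2) set \<Rightarrow> (real^2 \<Rightarrow> 'a::{real_normed_field, euclidean_space}) set" where
  "W12_0 D = {u. square_integrable D u \<and>
     (\<exists>g. square_integrable D g \<and> has_weak_gradient D u g \<and>
       (\<exists>\<phi> :: nat \<Rightarrow> real^2 \<Rightarrow> 'a. (\<forall>n. \<phi> n \<in> test_functions D) \<and>
          (\<lambda>n. norm_L2 D (\<lambda>x. \<phi> n x - u x)) \<longlonglongrightarrow> 0 \<and>
          (\<lambda>n. norm_L2 D (\<lambda>x. grad (\<phi> n) x - g x)) \<longlonglongrightarrow> 0))}"

definition nontrivial_on :: "(real^2) set \<Rightarrow> (real^2 \<Rightarrow> 'a::zero) \<Rightarrow> bool" where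
  "nontrivial_on D u \<longleftrightarrow> \<not> (AE x in lebesgue_on D. u x = 0)"

text \<open>
  \<open>C\<^sub>2\<close> is an admissible constant in the Moser--Trudinger inequality. Only real-valued functions
  are tested, which is the weaker requirement on \<open>C\<^sub>2\<close>. The integral is the extended
  nonnegative one, so its finiteness is part of the inequality.
\<close>

definition Moser_Trudinger_constant :: "real \<Rightarrow> bool" where
  "Moser_Trudinger_constant C\<^sub>2 \<longleftrightarrow>
     (\<forall>D (u :: real^2 \<Rightarrow> real) g. bounded_domain D \<and> u \<in> W12_0 D \<and> has_weak_gradient D u g \<and>
        nontrivial_on D u \<longrightarrow>
        (\<integral>\<^sup>+ x. ennreal (exp (4 * pi * (\<bar>u x\<bar> / norm_L2 D g)\<^sup>2) - 1) \<partial>lebesgue_on D)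
          \<le> ennreal (C\<^sub>2 * measure lebesgue D))"

definition L_log_L :: "(real^2) set \<Rightarrow> (real^2 \<Rightarrow> real) set" where
  "L_log_L D = {f \<in> borel_measurable (lebesgue_on D).
     (\<integral>\<^sup>+ x. ennreal (\<bar>f x\<bar> * (1 + max 0 (ln \<bar>f x\<bar>))) \<partial>lebesgue_on D) < \<infinity>}"

definition N_fun :: "real \<Rightarrow> real" where
  "N_fun y = (if y \<ge> 1 then y * ln y - y + 1 else 0)"

text \<open>
  Meaningful for \<open>f\<close> in \<open>L log L(D)\<close>, where all the integrals below are finite.
\<close>

definition norm_N :: "real \<Rightarrow> (real^2) set \<Rightarrow> (real^2 \<Rightarrow> real) \<Rightarrow> real" where
  "norm_N C\<^sub>2 D f = (INF l\<in>{0<..}.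
     l + l / (C\<^sub>2 * measure lebesgue D) * (\<integral>x. N_fun (\<bar>f x\<bar> / l) \<partial>lebesgue_on D))"

text \<open>
  Distributional solutions of \<open>-\<Delta>u - Vu = Eu\<close>. For \<open>V\<close> in \<open>L log L(D)\<close> and \<open>u\<close> in
  \<open>W\<^sub>0\<^sup>1\<^sup>,\<^sup>2(D)\<close> the product \<open>V u\<close> is integrable, by Orlicz duality and the Moser--Trudinger inequality.
\<close>

definition distributional_solution ::
  "(real^2) set \<Rightarrow> (real^2 \<Rightarrow> real) \<Rightarrow> real \<Rightarrow>
   (real^2 \<Rightarrow> 'a::{real_normed_field, euclidean_space}) \<Rightarrow> bool"
where
  "distributional_solution D V E u \<longleftrightarrow> (\<exists>g. has_weak_gradient D u g \<and>
     (\<forall>\<psi> \<in> test_functions D.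
        (\<integral>x. (\<Sum>i\<in>UNIV. g x $ i * grad \<psi> x $ i) \<partial>lebesgue_on D)
          = (\<integral>x. of_real (V x + E) * u x * \<psi> x \<partial>lebesgue_on D)))"

end

theory Submission
  imports Defs
begin

text \<open>
  Testing the equation with approximants of \<open>u\<close> gives the energy identity
  \<open>\<parallel>\<nabla>u\<parallel>\<^sup>2 = \<integral> V u\<^sup>2 + E \<parallel>u\<parallel>\<^sup>2 \<le> \<integral> V\<^sub>+ u\<^sup>2\<close>. For \<open>\<lambda> > 0\<close>, Young's inequality \<open>s t \<le> N(s) + e\<^sup>t - 1\<close>
  with \<open>s = V\<^sub>+ / \<lambda>\<close> and \<open>t = 4\<pi> u\<^sup>2 / \<parallel>\<nabla>u\<parallel>\<^sup>2\<close>, together with the Moser--Trudinger inequality, bounds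
  the right-hand side by \<open>\<lambda> \<parallel>\<nabla>u\<parallel>\<^sup>2 / (4\<pi>) (\<integral> N(V\<^sub>+ / \<lambda>) + C\<^sub>2 |D|)\<close>. Dividing by \<open>\<parallel>\<nabla>u\<parallel>\<^sup>2\<close> and taking
  the infimum over \<open>\<lambda>\<close> gives the claim. The same duality, applied to \<open>u\<close> and \<open>\<phi>\<^sub>n - u\<close>, justifies the
  passage to the limit in \<open>\<integral> V u \<phi>\<^sub>n\<close>. For values in a general normed field, all this is applied
  to a nonzero real component of \<open>u\<close>.
\<close>

subsection \<open>Smooth functions of compact support\<close>

lemma grad_bounded_linear:
  fixes f :: "real^2 \<Rightarrow> 'a::real_normed_vector" and L :: "'a \<Rightarrow> 'b::real_normed_vector"
  assumes "bounded_linear L" "f differentiable (at x)"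
  shows "(\<lambda>x. L (f x)) differentiable (at x)"
    and "grad (\<lambda>x. L (f x)) x $ i = L (grad f x $ i)"
proof -
  have "((\<lambda>x. L (f x)) has_derivative (\<lambda>h. L (frechet_derivative f (at x) h))) (at x)"
    using assms frechet_derivative_works bounded_linear.has_derivative by blast
  then show "(\<lambda>x. L (f x)) differentiable (at x)" "grad (\<lambda>x. L (f x)) x $ i = L (grad f x $ i)"
    using frechet_derivative_at[of "\<lambda>x. L (f x)"] by (auto simp: differentiable_def grad_def)
qed

lemma grad_diff:
  fixes f g :: "real^2 \<Rightarrow> 'a::real_normed_vector"
  assumes "f differentiable (at x)" "g differentiable (at x)"
  shows "grad (\<lambda>x. f x - g x) x = grad f x - grad g x"
proof -
  have "((\<lambda>x. f x - g x) has_derivative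
      (\<lambda>h. frechet_derivative f (at x) h - frechet_derivative g (at x) h)) (at x)"
    using assms frechet_derivative_works has_derivative_diff by blast
  then show ?thesis
    using frechet_derivative_at[of "\<lambda>x. f x - g x"] by (auto simp: grad_def vec_eq_iff)
qed

text \<open>\<open>grad\<close> records the derivative only along the axes; linearity recovers it in
  every direction.\<close>

lemma frechet_derivative_eq_grad:
  fixes f :: "real^2 \<Rightarrow> real"
  assumes "f differentiable (at x)"
  shows "frechet_derivative f (at x) h = grad f x \<bullet> h"
proof -
  interpret linear "frechet_derivative f (at x)"
    using assms linear_frechet_derivative by blast
  have "frechet_derivative f (at x) h = frechet_derivative f (at x) (\<Sum>i\<in>UNIV. h $ i *\<^sub>R axis i 1)"
    using basis_expansion[of h] by (simp add: scalar_mult_eq_scaleR)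
  also have "\<dots> = grad f x \<bullet> h"
    by (simp add: sum scale grad_def inner_vec_def mult.commute)
  finally show ?thesis .
qed

lemma C_k_continuous: "C_k k f \<Longrightarrow> continuous_on UNIV f"
  by (cases k) (auto simp: differentiable_imp_continuous_within continuous_on_eq_continuous_within)

lemma C_k_bounded_linear:
  fixes L :: "'a::real_normed_vector \<Rightarrow> 'b::real_normed_vector"
  assumes L: "bounded_linear L"
  shows "C_k k f \<Longrightarrow> C_k k (\<lambda>x. L (f x))"
proof (induction k arbitrary: f)
  case 0
  then show ?case
    by (simp add: L bounded_linear.continuous_on)
next
  case (Suc k)
  then have "(\<lambda>x. grad (\<lambda>x. L (f x)) x $ i) = (\<lambda>x. L (grad f x $ i))" for i
    using grad_bounded_linear(2)[OF L] by force
  with Suc show ?case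
    using grad_bounded_linear(1)[OF L] by simp
qed

lemma C_k_diff: "C_k k f \<Longrightarrow> C_k k g \<Longrightarrow> C_k k (\<lambda>x. f x - g x)"
proof (induction k arbitrary: f g)
  case 0
  then show ?case
    by (simp add: continuous_on_diff)
next
  case (Suc k)
  then have "(\<lambda>x. grad (\<lambda>x. f x - g x) x $ i) = (\<lambda>x. grad f x $ i - grad g x $ i)" for i
    by (simp add: grad_diff)
  with Suc show ?case
    by simp
qed

section \<open>Closure properties of the space of test functions\<close>

lemma test_functions_continuous: "\<psi> \<in> test_functions D \<Longrightarrow> continuous_on UNIV \<psi>"
  unfolding test_functions_def using C_k_continuous by blast

lemma test_functions_differentiable: "\<psi> \<in> test_functions D \<Longrightarrow> \<psi> differentiable (at x)"
proof -
  assume "\<psi> \<in> test_functions D"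
  then have "C_k (Suc 0) \<psi>"
    unfolding test_functions_def by blast
  then show ?thesis
    by simp
qed

lemma grad_outside_support:
  fixes \<psi> :: "real^2 \<Rightarrow> 'a::real_normed_vector"
  assumes x: "x \<notin> closure {x. \<psi> x \<noteq> 0}"
  shows "grad \<psi> x = 0"
proof -
  have "(\<psi> has_derivative (\<lambda>h. 0)) (at x)"
    by (rule has_derivative_transform_within_open[of "\<lambda>x. 0" _ _ _ "- closure {x. \<psi> x \<noteq> 0}"])
      (use x closure_subset[of "{x. \<psi> x \<noteq> 0}"] in auto)
  then have "frechet_derivative \<psi> (at x) = (\<lambda>h. 0)"
    using frechet_derivative_at by metis
  then show ?thesis
    by (simp add: grad_def vec_eq_iff)
qed

lemma test_functions_support:
  assumes "\<psi> \<in> test_functions D"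
  obtains K where "compact K" "K \<subseteq> D" "\<And>x. x \<notin> K \<Longrightarrow> \<psi> x = 0" "\<And>x. x \<notin> K \<Longrightarrow> grad \<psi> x = 0"
proof
  let ?K = "closure {x. \<psi> x \<noteq> 0}"
  show "compact ?K" "?K \<subseteq> D"
    using assms by (auto simp: test_functions_def)
  show "\<psi> x = 0" if "x \<notin> ?K" for x
    using that closure_subset[of "{x. \<psi> x \<noteq> 0}"] by auto
  show "grad \<psi> x = 0" if "x \<notin> ?K" for x
    using that by (rule grad_outside_support)
qed

text \<open>A common criterion for partial derivatives and linear images: smoothness is checked
  separately, and a closed subset of a compact support is compact.\<close>

lemma test_functions_mono_support:
  assumes "\<phi> \<in> test_functions D" "\<And>k. C_k k \<psi>" "{x. \<psi> x \<noteq> 0} \<subseteq> closure {x. \<phi> x \<noteq> 0}"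
  shows "\<psi> \<in> test_functions D"
proof -
  have "closure {x. \<psi> x \<noteq> 0} \<subseteq> closure {x. \<phi> x \<noteq> 0}"
    using assms(3) by (simp add: closure_minimal)
  moreover from this have "compact (closure {x. \<psi> x \<noteq> 0})"
    using assms(1) compact_Int_closed[of "closure {x. \<phi> x \<noteq> 0}" "closure {x. \<psi> x \<noteq> 0}"]
    by (simp add: test_functions_def Int_absorb1)
  ultimately show ?thesis
    using assms(1,2) by (auto simp: test_functions_def)
qed

lemma test_functions_partial:
  assumes "\<psi> \<in> test_functions D"
  shows "(\<lambda>x. grad \<psi> x $ i) \<in> test_functions D"
proof (rule test_functions_mono_support[OF assms])
  \<comment> \<open>Differentiation costs one order of smoothness, and every order is
    available.\<close>
  have "C_k (Suc k) \<psi>" for k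
    using assms unfolding test_functions_def by blast
  then show "C_k k (\<lambda>x. grad \<psi> x $ i)" for k
    by simp
  show "{x. grad \<psi> x $ i \<noteq> 0} \<subseteq> closure {x. \<psi> x \<noteq> 0}"
    using grad_outside_support[of _ \<psi>] by force
qed

lemma test_functions_bounded_linear:
  fixes L :: "'a::real_normed_vector \<Rightarrow> 'b::real_normed_vector"
  assumes "bounded_linear L" "\<psi> \<in> test_functions D"
  shows "(\<lambda>x. L (\<psi> x)) \<in> test_functions D"
proof (rule test_functions_mono_support[OF assms(2)])
  show "C_k k (\<lambda>x. L (\<psi> x))" for k
    using assms C_k_bounded_linear unfolding test_functions_def by blast
  show "{x. L (\<psi> x) \<noteq> 0} \<subseteq> closure {x. \<psi> x \<noteq> 0}"
    using closure_subset[of "{x. \<psi> x \<noteq> 0}"] linear_0[OF bounded_linear.linear[OF assms(1)]] by force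
qed

lemma test_functions_diff:
  assumes "\<phi> \<in> test_functions D" "\<psi> \<in> test_functions D"
  shows "(\<lambda>x. \<phi> x - \<psi> x) \<in> test_functions D"
proof -
  have "closure {x. \<phi> x - \<psi> x \<noteq> 0} \<subseteq> closure {x. \<phi> x \<noteq> 0} \<union> closure {x. \<psi> x \<noteq> 0}"
    unfolding closure_Un[symmetric] by (rule closure_mono) auto
  moreover have K: "compact (closure {x. \<phi> x \<noteq> 0} \<union> closure {x. \<psi> x \<noteq> 0})"
    and "closure {x. \<phi> x \<noteq> 0} \<union> closure {x. \<psi> x \<noteq> 0} \<subseteq> D"
    using assms by (auto simp: test_functions_def)
  moreover from this(1) have "compact (closure {x. \<phi> x - \<psi> x \<noteq> 0})"
    using compact_Int_closed[OF K closed_closure[of "{x. \<phi> x - \<psi> x \<noteq> 0}"]] calculation(1)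
    by (simp add: Int_absorb1)
  ultimately have "compact (closure {x. \<phi> x - \<psi> x \<noteq> 0})" "closure {x. \<phi> x - \<psi> x \<noteq> 0} \<subseteq> D"
    by auto
  then show ?thesis
    using assms C_k_diff unfolding test_functions_def by blast
qed

lemma grad_continuous:
  assumes "\<psi> \<in> test_functions D"
  shows "continuous_on UNIV (grad \<psi>)"
proof -
  have "continuous_on UNIV (\<lambda>x. grad \<psi> x $ i)" for i
    using assms test_functions_continuous test_functions_partial by blast
  then have "continuous_on UNIV (\<lambda>x. \<chi> i. grad \<psi> x $ i)"
    by (rule continuous_on_vec_lambda)
  then show ?thesis
    by simp
qed

lemma borel_measurable_lebesgue_on_continuous:
  fixes f :: "'a::euclidean_space \<Rightarrow> 'b::euclidean_space"
  assumes "continuous_on UNIV f"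
  shows "f \<in> borel_measurable (lebesgue_on S)"
  by (metis assms borel_measurable_continuous_onI measurable_completion measurable_lborel2
      measurable_restrict_space1)

text \<open>The function is constant on the whole plane, and the constant is 0 because a compact
  support misses some point.\<close>

lemma grad_eq_0_imp_eq_0:
  fixes \<psi> :: "real^2 \<Rightarrow> real"
  assumes "\<psi> \<in> test_functions D" "\<And>x. grad \<psi> x = 0"
  shows "\<psi> x = 0"
proof -
  obtain K where K: "compact K" "\<And>x. x \<notin> K \<Longrightarrow> \<psi> x = 0"
    using test_functions_support[OF assms(1)] by metis
  obtain y where "y \<notin> K"
    using compact_imp_bounded[OF K(1)] not_bounded_UNIV by (metis UNIV_eq_I)
  have "(\<psi> has_derivative (\<lambda>h. 0)) (at x within UNIV)" for x
  proof -
    have \<psi>: "\<psi> differentiable (at x)"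
      using assms(1) by (rule test_functions_differentiable)
    then have "frechet_derivative \<psi> (at x) = (\<lambda>h. 0)"
      by (simp add: fun_eq_iff frechet_derivative_eq_grad assms(2))
    with \<psi> show ?thesis
      by (simp add: frechet_derivative_works)
  qed
  then obtain c where "\<And>x. \<psi> x = c"
    using has_derivative_zero_constant[of UNIV \<psi>] by auto
  with K(2)[OF \<open>y \<notin> K\<close>] show ?thesis
    by metis
qed

subsection \<open>Square-integrable functions\<close>

lemma integrable_inner_square_integrable:
  fixes f g :: "'a \<Rightarrow> 'b::euclidean_space"
  assumes [measurable]: "f \<in> borel_measurable M" "g \<in> borel_measurable M"
    and "integrable M (\<lambda>x. (norm (f x))\<^sup>2)" "integrable M (\<lambda>x. (norm (g x))\<^sup>2)"
  shows "integrable M (\<lambda>x. f x \<bullet> g x)"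
proof (rule Bochner_Integration.integrable_bound)
  show "integrable M (\<lambda>x. (norm (f x))\<^sup>2 + (norm (g x))\<^sup>2)"
    using assms by simp
  have "\<bar>f x \<bullet> g x\<bar> \<le> (norm (f x))\<^sup>2 + (norm (g x))\<^sup>2" for x
    using Cauchy_Schwarz_ineq2[of "f x" "g x"] sum_squares_bound[of "norm (f x)" "norm (g x)"]
      mult_nonneg_nonneg[OF norm_ge_zero norm_ge_zero, of "f x" "g x"] by linarith
  then show "AE x in M. norm (f x \<bullet> g x) \<le> norm ((norm (f x))\<^sup>2 + (norm (g x))\<^sup>2)"
    by simp
qed measurable

text \<open>Discriminant argument: the integral of
  \<open>(norm (f x + t *\<^sub>R g x))\<^sup>2\<close> is a quadratic polynomial in
  \<open>t\<close> that is never negative.\<close>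

lemma Cauchy_Schwarz_integral:
  fixes f g :: "'a \<Rightarrow> 'b::euclidean_space"
  assumes [measurable]: "f \<in> borel_measurable M" "g \<in> borel_measurable M"
    and f: "integrable M (\<lambda>x. (norm (f x))\<^sup>2)" and g: "integrable M (\<lambda>x. (norm (g x))\<^sup>2)"
  shows "\<bar>\<integral>x. f x \<bullet> g x \<partial>M\<bar> \<le> sqrt (\<integral>x. (norm (f x))\<^sup>2 \<partial>M) * sqrt (\<integral>x. (norm (g x))\<^sup>2 \<partial>M)"
proof -
  define A where "A = (\<integral>x. (norm (f x))\<^sup>2 \<partial>M)"
  define B where "B = (\<integral>x. (norm (g x))\<^sup>2 \<partial>M)"
  define C where "C = (\<integral>x. f x \<bullet> g x \<partial>M)"
  have fg: "integrable M (\<lambda>x. f x \<bullet> g x)"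
    using assms by (rule integrable_inner_square_integrable)
  have quad: "A + 2 * t * C + t\<^sup>2 * B \<ge> 0" for t :: real
  proof -
    have "0 \<le> (\<integral>x. (norm (f x + t *\<^sub>R g x))\<^sup>2 \<partial>M)"
      by simp
    also have "\<dots> = (\<integral>x. (norm (f x))\<^sup>2 + 2 * t * (f x \<bullet> g x) + t\<^sup>2 * (norm (g x))\<^sup>2 \<partial>M)"
      by (rule Bochner_Integration.integral_cong)
        (simp_all only: power2_norm_eq_inner, simp add: inner_commute algebra_simps power2_eq_square)
    also have "\<dots> = A + 2 * t * C + t\<^sup>2 * B"
      using f g fg by (simp add: A_def B_def C_def)
    finally show ?thesis .
  qed
  have "A \<ge> 0" "B \<ge> 0"
    by (simp_all add: A_def B_def)
  have "C\<^sup>2 \<le> A * B"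
  proof (cases "B = 0")
    case True
    \<comment> \<open>The polynomial is now affine in \<open>t\<close>; if \<open>C\<close> were
      nonzero, the chosen \<open>t\<close> would give it the value -1.\<close>
    then have "C = 0"
      using quad[of "- (A + 1) / (2 * C)"] \<open>A \<ge> 0\<close> by (cases "C = 0") (auto simp: field_simps)
    with \<open>A \<ge> 0\<close> \<open>B \<ge> 0\<close> show ?thesis
      by simp
  next
    case False
    with \<open>B \<ge> 0\<close> have "B > 0"
      by simp
    \<comment> \<open>The minimiser \<open>- C / B\<close> of the quadratic gives
      \<open>A - C\<^sup>2 / B \<ge> 0\<close>.\<close>
    then show ?thesis
      using quad[of "- C / B"] by (simp add: field_simps power2_eq_square)
  qed
  then have "\<bar>C\<bar> \<le> sqrt (A * B)"
    by (simp add: real_le_rsqrt)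
  then show ?thesis
    by (simp add: A_def B_def C_def real_sqrt_mult)
qed

lemma integrable_norm_square_diff:
  fixes f g :: "'a \<Rightarrow> 'b::euclidean_space"
  assumes [measurable]: "f \<in> borel_measurable M" "g \<in> borel_measurable M"
    and "integrable M (\<lambda>x. (norm (f x))\<^sup>2)" "integrable M (\<lambda>x. (norm (g x))\<^sup>2)"
  shows "integrable M (\<lambda>x. (norm (f x - g x))\<^sup>2)"
proof -
  have "integrable M (\<lambda>x. (norm (f x))\<^sup>2 - 2 * (f x \<bullet> g x) + (norm (g x))\<^sup>2)"
    using assms integrable_inner_square_integrable[OF assms] by simp
  then show ?thesis
    by (simp add: power2_norm_eq_inner inner_diff inner_commute algebra_simps)
qed

section \<open>The same facts for \<open>square_integrable\<close> and \<open>norm_L2\<close> on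
  \<open>D\<close>\<close>

lemma square_integrable_diff:
  "square_integrable D f \<Longrightarrow> square_integrable D g \<Longrightarrow> square_integrable D (\<lambda>x. f x - g x)"
  unfolding square_integrable_def by (auto intro: integrable_norm_square_diff borel_measurable_diff)

lemma integrable_inner_L2:
  "square_integrable D f \<Longrightarrow> square_integrable D g \<Longrightarrow> integrable (lebesgue_on D) (\<lambda>x. f x \<bullet> g x)"
  unfolding square_integrable_def by (auto intro: integrable_inner_square_integrable)

lemma Cauchy_Schwarz_L2:
  "square_integrable D f \<Longrightarrow> square_integrable D g \<Longrightarrow>
    \<bar>\<integral>x. f x \<bullet> g x \<partial>lebesgue_on D\<bar> \<le> norm_L2 D f * norm_L2 D g"
  unfolding square_integrable_def norm_L2_def by (auto intro: Cauchy_Schwarz_integral)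

lemma norm_L2_nonneg: "norm_L2 D f \<ge> 0"
  by (simp add: norm_L2_def)

lemma norm_L2_square: "(norm_L2 D f)\<^sup>2 = (\<integral>x. (norm (f x))\<^sup>2 \<partial>lebesgue_on D)"
  by (simp add: norm_L2_def)

lemma norm_L2_eq_0:
  assumes "square_integrable D f" "norm_L2 D f = 0"
  shows "AE x in lebesgue_on D. f x = 0"
proof -
  have "(\<integral>x. (norm (f x))\<^sup>2 \<partial>lebesgue_on D) = 0"
    using assms by (simp add: norm_L2_def)
  then show ?thesis
    using assms integral_nonneg_eq_0_iff_AE[of "lebesgue_on D" "\<lambda>x. (norm (f x))\<^sup>2"]
    by (simp add: square_integrable_def)
qed

lemma norm_L2_minus_commute: "norm_L2 D (\<lambda>x. f x - g x) = norm_L2 D (\<lambda>x. g x - f x)"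
  by (simp add: norm_L2_def norm_minus_commute)

text \<open>Cauchy-Schwarz applied to \<open>g\<close> and \<open>f n - h\<close>. This lets the
  gradient term and the \<open>E\<close> term of the equation pass to the limit.\<close>

lemma tendsto_integral_inner_L2:
  fixes f :: "nat \<Rightarrow> real^2 \<Rightarrow> 'a::euclidean_space"
  assumes g: "square_integrable D g" and h: "square_integrable D h"
    and f: "\<And>n. square_integrable D (f n)" and lim: "(\<lambda>n. norm_L2 D (\<lambda>x. f n x - h x)) \<longlonglongrightarrow> 0"
  shows "(\<lambda>n. \<integral>x. g x \<bullet> f n x \<partial>lebesgue_on D) \<longlonglongrightarrow> (\<integral>x. g x \<bullet> h x \<partial>lebesgue_on D)"
proof (rule LIM_zero_cancel, rule Lim_null_comparison)
  show "\<forall>\<^sub>F n in sequentially. norm ((\<integral>x. g x \<bullet> f n x \<partial>lebesgue_on D) - (\<integral>x. g x \<bullet> h x \<partial>lebesgue_on D))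
      \<le> norm_L2 D g * norm_L2 D (\<lambda>x. f n x - h x)"
  proof (rule always_eventually, rule allI)
    fix n
    have "(\<integral>x. g x \<bullet> f n x \<partial>lebesgue_on D) - (\<integral>x. g x \<bullet> h x \<partial>lebesgue_on D)
        = (\<integral>x. g x \<bullet> (f n x - h x) \<partial>lebesgue_on D)"
      using integrable_inner_L2[OF g f] integrable_inner_L2[OF g h] by (simp add: inner_diff_right)
    then show "norm ((\<integral>x. g x \<bullet> f n x \<partial>lebesgue_on D) - (\<integral>x. g x \<bullet> h x \<partial>lebesgue_on D))
        \<le> norm_L2 D g * norm_L2 D (\<lambda>x. f n x - h x)"
      using Cauchy_Schwarz_L2[OF g square_integrable_diff[OF f h]] by simp
  qed
  show "(\<lambda>n. norm_L2 D g * norm_L2 D (\<lambda>x. f n x - h x)) \<longlonglongrightarrow> 0"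
    using tendsto_mult_left[OF lim, of "norm_L2 D g"] by simp
qed

subsection \<open>Integration by parts\<close>

lemma integrable_lborel_continuous_compact_support:
  fixes f :: "'a::euclidean_space \<Rightarrow> 'b::euclidean_space"
  assumes "continuous_on UNIV f" "compact K" "\<And>x. x \<notin> K \<Longrightarrow> f x = 0"
  shows "integrable lborel f"
proof -
  have "integrable lborel (\<lambda>x. indicator K x *\<^sub>R f x)"
    using assms borel_integrable_compact continuous_on_subset by blast
  moreover have "(\<lambda>x. indicator K x *\<^sub>R f x) = f"
    using assms(3) by (auto simp: indicator_def)
  ultimately show ?thesis
    by simp
qed

text \<open>Since \<open>f\<close> vanishes off a subset of \<open>D\<close>, restricting to
  \<open>D\<close> loses nothing. Integrals over \<open>D\<close> can thus be moved to the whole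
  plane, where Lebesgue measure is translation invariant.\<close>

lemma lebesgue_on_compact_support:
  fixes f :: "'a::euclidean_space \<Rightarrow> 'b::euclidean_space"
  assumes cont: "continuous_on UNIV f" and K: "compact K" "K \<subseteq> D" "\<And>x. x \<notin> K \<Longrightarrow> f x = 0"
    and D: "D \<in> sets lebesgue"
  shows integrable_lebesgue_on_compact_support: "integrable (lebesgue_on D) f"
    and integral_lebesgue_on_compact_support: "integral\<^sup>L (lebesgue_on D) f = integral\<^sup>L lborel f"
proof -
  have eq: "(\<lambda>x. indicator D x *\<^sub>R f x) = f"
    using K(2,3) by (force simp: fun_eq_iff indicator_def)
  have f: "f \<in> borel_measurable lborel"
    using cont by (simp add: borel_measurable_continuous_onI)
  show "integrable (lebesgue_on D) f"
    using D f integrable_lborel_continuous_compact_support[OF cont K(1,3)]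
    by (simp add: integrable_restrict_space eq integrable_completion)
  show "integral\<^sup>L (lebesgue_on D) f = integral\<^sup>L lborel f"
    using D f by (simp add: integral_restrict_space eq integral_completion)
qed

lemma locally_integrable_continuous:
  fixes f :: "real^2 \<Rightarrow> 'b::euclidean_space"
  assumes "continuous_on UNIV f"
  shows "locally_integrable D f"
  unfolding locally_integrable_def
proof (intro allI impI)
  fix K :: "(real^2) set"
  assume K: "compact K \<and> K \<subseteq> D"
  then have "K \<in> sets borel"
    by (simp add: compact_imp_closed)
  have "integrable lborel (\<lambda>x. indicator K x *\<^sub>R f x)"
    using K assms borel_integrable_compact continuous_on_subset by blast
  then show "integrable (lebesgue_on K) f"
    using \<open>K \<in> sets borel\<close> borel_measurable_integrable[of lborel "\<lambda>x. indicator K x *\<^sub>R f x"]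
    by (simp add: integrable_restrict_space integrable_completion)
qed

text \<open>On the compact support \<open>\<psi>\<close> is bounded and \<open>f\<close> is
  integrable; elsewhere the product is 0. The integrals that define weak gradients are therefore
  genuine for real test functions, not the default value 0, and may be split linearly.\<close>

lemma integrable_locally_integrable_scaleR:
  fixes f :: "real^2 \<Rightarrow> 'a::euclidean_space" and \<psi> :: "real^2 \<Rightarrow> real"
  assumes f: "locally_integrable D f" and \<psi>: "\<psi> \<in> test_functions D" and D: "D \<in> sets lebesgue"
  shows "integrable (lebesgue_on D) (\<lambda>x. \<psi> x *\<^sub>R f x)"
proof -
  obtain K where K: "compact K" "K \<subseteq> D" "\<And>x. x \<notin> K \<Longrightarrow> \<psi> x = 0"
    using test_functions_support[OF \<psi>] by metis
  have cont: "continuous_on UNIV \<psi>"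
    using \<psi> by (rule test_functions_continuous)
  then obtain B where B: "\<And>x. x \<in> K \<Longrightarrow> \<bar>\<psi> x\<bar> \<le> B"
    using compact_imp_bounded[OF compact_continuous_image[OF continuous_on_subset K(1)]]
    by (force simp: bounded_iff)
  have fK: "integrable (lebesgue_on K) f"
    using f K by (simp add: locally_integrable_def)
  have "integrable (lebesgue_on K) (\<lambda>x. \<psi> x *\<^sub>R f x)"
  proof (rule Bochner_Integration.integrable_bound)
    show "integrable (lebesgue_on K) (\<lambda>x. B *\<^sub>R f x)"
      using fK by simp
    show "(\<lambda>x. \<psi> x *\<^sub>R f x) \<in> borel_measurable (lebesgue_on K)"
      using fK borel_measurable_lebesgue_on_continuous[OF cont] by (intro borel_measurable_scaleR) auto
    show "AE x in lebesgue_on K. norm (\<psi> x *\<^sub>R f x) \<le> norm (B *\<^sub>R f x)"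
      using B by (intro AE_I2) (force intro!: mult_right_mono)
  qed
  moreover have "K \<in> sets lebesgue"
    using K(1) by (simp add: borel_compact)
  moreover have "(\<lambda>x. indicator K x *\<^sub>R \<psi> x *\<^sub>R f x) = (\<lambda>x. indicator D x *\<^sub>R \<psi> x *\<^sub>R f x)"
    using K by (auto simp: indicator_def fun_eq_iff)
  ultimately show ?thesis
    using D by (simp add: integrable_restrict_space)
qed

text \<open>Differentiate the translation-invariant integral under the integral sign.\<close>

lemma integral_directional_derivative_eq_0:
  fixes f :: "'a::euclidean_space \<Rightarrow> real"
  assumes diff: "\<And>x. (f has_derivative f' x) (at x)"
    and cont: "continuous_on UNIV (\<lambda>x. f' x e)"
    and supp: "compact K" "\<And>x. x \<notin> K \<Longrightarrow> f x = 0" "\<And>x. x \<notin> K \<Longrightarrow> f' x e = 0"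
  shows "(\<integral>x. f' x e \<partial>lborel) = 0"
proof -
  \<comment> \<open>Step sizes of the difference quotients: nonzero, tending to 0, and at most 1, so
    that all translates stay within distance \<open>norm e\<close>.\<close>
  define h where "h n = 1 / real (Suc n)" for n
  have h: "0 < h n" "h n \<le> 1" for n
    by (auto simp: h_def)
  have "h \<longlonglongrightarrow> 0"
    unfolding h_def by (rule LIMSEQ_Suc[OF lim_1_over_n])
  have f_cont: "continuous_on UNIV f"
    using diff has_derivative_continuous continuous_on_eq_continuous_within by blast
  have [measurable]: "f \<in> borel_measurable borel" "(\<lambda>x. f' x e) \<in> borel_measurable borel"
    using f_cont cont by (auto intro: borel_measurable_continuous_onI)
  have f_int: "integrable lborel f"
    using f_cont supp(1,2) by (rule integrable_lborel_continuous_compact_support)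
  obtain B where B: "\<And>x. \<bar>f' x e\<bar> \<le> B"
  proof -
    obtain B where "\<And>x. x \<in> K \<Longrightarrow> \<bar>f' x e\<bar> \<le> B"
      using compact_imp_bounded[OF compact_continuous_image[OF continuous_on_subset[OF cont] supp(1)]]
      by (force simp: bounded_iff)
    then have "\<bar>f' x e\<bar> \<le> max B 0" for x
      using supp(3)[of x] by (cases "x \<in> K") (auto simp: le_max_iff_disj)
    with that show ?thesis by blast
  qed
  obtain R where R: "K \<subseteq> cball 0 R"
    using compact_imp_bounded[OF supp(1)] bounded_subset_ballD[of K 0] ball_subset_cball[of 0] by (metis subset_trans)
  define s where "s n x = (f (x + h n *\<^sub>R e) - f x) / h n" for n x
  \<comment> \<open>The dominating function: \<open>B\<close> bounds the quotients by the mean value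
    inequality, and the enlarged ball contains every point where some quotient is nonzero.\<close>
  define w where "w x = B * indicator (cball 0 (R + norm e)) x" for x :: 'a
  \<comment> \<open>Translation invariance: the two terms of the difference quotient have the same
    integral.\<close>
  have "(\<integral>x. s n x \<partial>lborel) = 0" for n
  proof -
    have "integral\<^sup>L lborel f = integral\<^sup>L (distr lborel borel ((+) (h n *\<^sub>R e))) f"
      by (simp add: lborel_distr_plus)
    also have "\<dots> = (\<integral>x. f (h n *\<^sub>R e + x) \<partial>lborel)"
      by (rule integral_distr) auto
    finally have shift: "(\<integral>x. f (x + h n *\<^sub>R e) \<partial>lborel) = integral\<^sup>L lborel f"
      by (simp add: add.commute)
    have "integrable (distr lborel borel ((+) (h n *\<^sub>R e))) f"
      using f_int by (simp add: lborel_distr_plus)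
    then have "integrable lborel (\<lambda>x. f (x + h n *\<^sub>R e))"
      by (subst (asm) integrable_distr_eq) (auto simp: add.commute)
    with shift f_int show ?thesis
      by (simp add: s_def)
  qed
  moreover have "(\<lambda>n. \<integral>x. s n x \<partial>lborel) \<longlonglongrightarrow> (\<integral>x. f' x e \<partial>lborel)"
  proof (rule integral_dominated_convergence)
    have "continuous_on UNIV (\<lambda>x. f (x + h n *\<^sub>R e))" for n
      by (intro continuous_on_compose2[OF f_cont] continuous_intros) auto
    then have [measurable]: "(\<lambda>x. f (x + h n *\<^sub>R e)) \<in> borel_measurable borel" for n
      by (rule borel_measurable_continuous_onI)
    show "s n \<in> borel_measurable lborel" for n
      unfolding s_def by measurable
    show "(\<lambda>x. f' x e) \<in> borel_measurable lborel"
      by measurable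
    show "integrable lborel w"
      unfolding w_def by (intro integrable_mult_right integrable_real_indicator)
        (use emeasure_compact_finite[OF compact_cball, of 0 "R + norm e"] in auto)
    \<comment> \<open>The derivative along the line through \<open>x\<close> in direction
      \<open>e\<close>; it serves both the pointwise limit at \<open>t = 0\<close> and the mean
      value bound.\<close>
    have line: "((\<lambda>t. f (x + t *\<^sub>R e)) has_derivative (\<lambda>k. f' (x + t *\<^sub>R e) e * k)) (at t within S)" for x t S
    proof -
      have "((\<lambda>t. f (x + t *\<^sub>R e)) has_derivative (\<lambda>k. f' (x + t *\<^sub>R e) (k *\<^sub>R e))) (at t within S)"
        by (rule has_derivative_compose[where f = "\<lambda>t. x + t *\<^sub>R e" and g = f and f' = "\<lambda>k. k *\<^sub>R e", OF _ diff])
          (auto intro!: derivative_eq_intros)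
      then show ?thesis
        using linear_cmul[OF has_derivative_linear[OF diff]] by (simp add: mult.commute)
    qed
    show "AE x in lborel. (\<lambda>n. s n x) \<longlonglongrightarrow> f' x e"
    proof (rule AE_I2)
      fix x
      have "((\<lambda>t. f (x + t *\<^sub>R e)) has_real_derivative f' x e) (at 0)"
        using line[of x 0 UNIV] by (simp add: has_field_derivative_def)
      then have "((\<lambda>t. (f (x + t *\<^sub>R e) - f x) / t) \<longlongrightarrow> f' x e) (at 0)"
        by (simp add: DERIV_def)
      moreover have "filterlim h (at 0) sequentially"
        using \<open>h \<longlonglongrightarrow> 0\<close> h(1) by (simp add: filterlim_at less_imp_neq[symmetric])
      ultimately show "(\<lambda>n. s n x) \<longlonglongrightarrow> f' x e"
        unfolding s_def by (rule filterlim_compose)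
    qed
    show "AE x in lborel. norm (s n x) \<le> w x" for n
    proof (rule AE_I2)
      fix x
      show "norm (s n x) \<le> w x"
      proof (cases "x \<in> cball 0 (R + norm e)")
        case True
        have "norm (f (x + h n *\<^sub>R e) - f (x + 0 *\<^sub>R e)) \<le> B * norm (h n - 0)"
        proof (rule differentiable_bound[where S = UNIV])
          show "((\<lambda>t. f (x + t *\<^sub>R e)) has_derivative (\<lambda>k. f' (x + t *\<^sub>R e) e * k)) (at t within UNIV)" for t
            by (rule line)
          show "onorm (\<lambda>k. f' (x + t *\<^sub>R e) e * k) \<le> B" for t
            using B by (intro onorm_le) (simp add: abs_mult mult_right_mono)
        qed auto
        with True h(1)[of n] show ?thesis
          by (simp add: s_def w_def field_simps)
      next
        case False
        \<comment> \<open>The shift is no longer than \<open>norm e\<close>, so \<open>x\<close> and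
          its translate both lie outside the ball that contains \<open>K\<close>, and the quotient
          is 0.\<close>
        have "norm (h n *\<^sub>R e) \<le> norm e"
          using h[of n] by (simp add: mult_left_le_one_le)
        then have "norm x \<le> norm (x + h n *\<^sub>R e) + norm e"
          using norm_triangle_ineq4[of "x + h n *\<^sub>R e" "h n *\<^sub>R e"] by simp
        moreover have "norm x > R + norm e"
          using False by simp
        ultimately have "norm x > R" "norm (x + h n *\<^sub>R e) > R"
          using norm_ge_zero[of e] by linarith+
        then have "x \<notin> cball 0 R" "x + h n *\<^sub>R e \<notin> cball 0 R"
          by simp_all
        with R supp(2) have "s n x = 0"
          unfolding s_def by (metis diff_zero div_0 subsetD)
        with False show ?thesis
          by (simp add: w_def)
      qed
    qed
  qed
  ultimately show ?thesis
    by (simp add: LIMSEQ_const_iff)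
qed

text \<open>The integral of a directional derivative of the compactly supported product
  \<open>\<phi> x * \<psi> x\<close> is 0; the product rule splits it into the two sides.\<close>

lemma test_functions_integration_by_parts:
  fixes \<phi> \<psi> :: "real^2 \<Rightarrow> real"
  assumes D: "D \<in> sets lebesgue" and \<phi>: "\<phi> \<in> test_functions D" and \<psi>: "\<psi> \<in> test_functions D"
  shows "(\<integral>x. \<phi> x * grad \<psi> x $ i \<partial>lebesgue_on D) = - (\<integral>x. grad \<phi> x $ i * \<psi> x \<partial>lebesgue_on D)"
proof -
  obtain K where K: "compact K" "K \<subseteq> D" "\<And>x. x \<notin> K \<Longrightarrow> \<psi> x = 0" "\<And>x. x \<notin> K \<Longrightarrow> grad \<psi> x = 0"
    using test_functions_support[OF \<psi>] by blast
  have c: "continuous_on UNIV \<phi>" "continuous_on UNIV \<psi>"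
    "continuous_on UNIV (\<lambda>x. grad \<phi> x $ i)" "continuous_on UNIV (\<lambda>x. grad \<psi> x $ i)"
    using \<phi> \<psi> by (auto intro: test_functions_continuous test_functions_partial)
  have int1: "integrable (lebesgue_on D) (\<lambda>x. \<phi> x * grad \<psi> x $ i)"
    by (rule integrable_lebesgue_on_compact_support[OF _ K(1,2) _ D])
      (auto intro!: continuous_intros c simp: K)
  have int2: "integrable (lebesgue_on D) (\<lambda>x. grad \<phi> x $ i * \<psi> x)"
    by (rule integrable_lebesgue_on_compact_support[OF _ K(1,2) _ D])
      (auto intro!: continuous_intros c simp: K)
  let ?f' = "\<lambda>x h. \<phi> x * frechet_derivative \<psi> (at x) h + frechet_derivative \<phi> (at x) h * \<psi> x"
  have f': "?f' x (axis i 1) = \<phi> x * grad \<psi> x $ i + grad \<phi> x $ i * \<psi> x" for x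
    by (simp add: grad_def)
  have cont: "continuous_on UNIV (\<lambda>x. ?f' x (axis i 1))"
    unfolding f' by (intro continuous_intros c)
  have zero: "?f' x (axis i 1) = 0" if "x \<notin> K" for x
    unfolding f' using K that by simp
  have "(\<integral>x. ?f' x (axis i 1) \<partial>lborel) = 0"
  proof (rule integral_directional_derivative_eq_0[where f = "\<lambda>x. \<phi> x * \<psi> x"])
    show "((\<lambda>x. \<phi> x * \<psi> x) has_derivative ?f' x) (at x)" for x
      using \<phi> \<psi> test_functions_differentiable frechet_derivative_works
      by (intro has_derivative_mult) blast+
    show "\<phi> x * \<psi> x = 0" if "x \<notin> K" for x
      using K that by simp
  qed (fact cont K zero)+
  then have "(\<integral>x. \<phi> x * grad \<psi> x $ i + grad \<phi> x $ i * \<psi> x \<partial>lebesgue_on D) = 0"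
    using integral_lebesgue_on_compact_support[OF cont K(1,2) zero D] by (simp add: f')
  with int1 int2 show ?thesis
    by simp
qed

subsection \<open>Sobolev functions together with a gradient\<close>

text \<open>\<open>W12_0\<close> hides the gradient behind an existential quantifier. Here it is a
  parameter, so that one fixed \<open>g\<close> is at once square integrable, a weak gradient and
  the limit of the approximating gradients.\<close>

definition W12_0_gradient ::
  "(real^2) set \<Rightarrow> (real^2 \<Rightarrow> 'a::{real_normed_field, euclidean_space}) \<Rightarrow> (real^2 \<Rightarrow> 'a^2) \<Rightarrow> bool"
where
  "W12_0_gradient D u g \<longleftrightarrow> square_integrable D u \<and> square_integrable D g \<and> has_weak_gradient D u g \<and>
     (\<exists>\<phi> :: nat \<Rightarrow> real^2 \<Rightarrow> 'a. (\<forall>n. \<phi> n \<in> test_functions D) \<and>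
        (\<lambda>n. norm_L2 D (\<lambda>x. \<phi> n x - u x)) \<longlonglongrightarrow> 0 \<and>
        (\<lambda>n. norm_L2 D (\<lambda>x. grad (\<phi> n) x - g x)) \<longlonglongrightarrow> 0)"

lemma W12_0_iff: "u \<in> W12_0 D \<longleftrightarrow> (\<exists>g. W12_0_gradient D u g)"
  by (auto simp: W12_0_def W12_0_gradient_def)

lemma square_integrable_test_function:
  fixes \<phi> :: "real^2 \<Rightarrow> 'a::euclidean_space"
  assumes D: "D \<in> sets lebesgue" and \<phi>: "\<phi> \<in> test_functions D"
  shows "square_integrable D \<phi>" "square_integrable D (grad \<phi>)"
proof -
  obtain K where K: "compact K" "K \<subseteq> D" "\<And>x. x \<notin> K \<Longrightarrow> \<phi> x = 0" "\<And>x. x \<notin> K \<Longrightarrow> grad \<phi> x = 0"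
    using test_functions_support[OF \<phi>] by blast
  have c: "continuous_on UNIV \<phi>" "continuous_on UNIV (grad \<phi>)"
    using \<phi> by (auto intro: test_functions_continuous grad_continuous)
  have "integrable (lebesgue_on D) (\<lambda>x. (norm (\<phi> x))\<^sup>2)"
    by (rule integrable_lebesgue_on_compact_support[OF _ K(1,2) _ D])
      (auto intro!: continuous_intros c simp: K)
  moreover have "integrable (lebesgue_on D) (\<lambda>x. (norm (grad \<phi> x))\<^sup>2)"
    by (rule integrable_lebesgue_on_compact_support[OF _ K(1,2) _ D])
      (auto intro!: continuous_intros c simp: K)
  ultimately show "square_integrable D \<phi>" "square_integrable D (grad \<phi>)"
    using c by (auto simp: square_integrable_def intro: borel_measurable_lebesgue_on_continuous)
qed

lemma has_weak_gradient_test_function: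
  fixes \<phi> :: "real^2 \<Rightarrow> real"
  assumes "D \<in> sets lebesgue" "\<phi> \<in> test_functions D"
  shows "has_weak_gradient D \<phi> (grad \<phi>)"
  using assms test_functions_integration_by_parts
  by (auto simp: has_weak_gradient_def
      intro: locally_integrable_continuous test_functions_continuous grad_continuous)

lemma has_weak_gradient_integrable:
  fixes u :: "real^2 \<Rightarrow> 'a::{real_normed_field, euclidean_space}"
  assumes "D \<in> sets lebesgue" "has_weak_gradient D u g" "\<psi> \<in> test_functions D"
  shows "integrable (lebesgue_on D) (\<lambda>x. \<psi> x *\<^sub>R u x)"
    and "integrable (lebesgue_on D) (\<lambda>x. \<psi> x *\<^sub>R g x $ i)"
proof -
  show "integrable (lebesgue_on D) (\<lambda>x. \<psi> x *\<^sub>R u x)"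
    using assms integrable_locally_integrable_scaleR by (auto simp: has_weak_gradient_def)
  have "integrable (lebesgue_on D) (\<lambda>x. \<psi> x *\<^sub>R g x)"
    using assms integrable_locally_integrable_scaleR by (auto simp: has_weak_gradient_def)
  from integrable_bounded_linear[OF bounded_linear_vec_nth this, of i]
  show "integrable (lebesgue_on D) (\<lambda>x. \<psi> x *\<^sub>R g x $ i)"
    by simp
qed

lemma has_weak_gradient_diff:
  fixes u v :: "real^2 \<Rightarrow> real"
  assumes D: "D \<in> sets lebesgue" and u: "has_weak_gradient D u g" and v: "has_weak_gradient D v h"
  shows "has_weak_gradient D (\<lambda>x. u x - v x) (\<lambda>x. g x - h x)"
  unfolding has_weak_gradient_def
proof (intro conjI ballI allI)
  show "locally_integrable D (\<lambda>x. u x - v x)" "locally_integrable D (\<lambda>x. g x - h x)"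
    using u v by (auto simp: has_weak_gradient_def locally_integrable_def)
next
  fix \<psi> :: "real^2 \<Rightarrow> real" and i :: 2
  assume \<psi>: "\<psi> \<in> test_functions D"
  note int = has_weak_gradient_integrable[OF D u] has_weak_gradient_integrable[OF D v]
  have "(\<integral>x. (u x - v x) * grad \<psi> x $ i \<partial>lebesgue_on D)
      = (\<integral>x. u x * grad \<psi> x $ i \<partial>lebesgue_on D) - (\<integral>x. v x * grad \<psi> x $ i \<partial>lebesgue_on D)"
    using int(1,3)[OF test_functions_partial[OF \<psi>, of i]]
    by (simp add: left_diff_distrib mult.commute[of "grad \<psi> _ $ i"])
  also have "\<dots> = - ((\<integral>x. g x $ i * \<psi> x \<partial>lebesgue_on D) - (\<integral>x. h x $ i * \<psi> x \<partial>lebesgue_on D))"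
    using u v \<psi> by (simp add: has_weak_gradient_def)
  also have "\<dots> = - (\<integral>x. (g x - h x) $ i * \<psi> x \<partial>lebesgue_on D)"
    using int(2,4)[OF \<psi>, of i] by (simp add: left_diff_distrib mult.commute[of "\<psi> _"])
  finally show "(\<integral>x. (u x - v x) * grad \<psi> x $ i \<partial>lebesgue_on D)
      = - (\<integral>x. (g x - h x) $ i * \<psi> x \<partial>lebesgue_on D)" .
qed

text \<open>The constant sequence is an approximating one.\<close>

lemma W12_0_gradient_test_function:
  fixes \<phi> :: "real^2 \<Rightarrow> real"
  assumes "D \<in> sets lebesgue" "\<phi> \<in> test_functions D"
  shows "W12_0_gradient D \<phi> (grad \<phi>)"
  unfolding W12_0_gradient_def
  using assms square_integrable_test_function[OF assms] has_weak_gradient_test_function[OF assms]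
  by (auto simp: norm_L2_def intro!: exI[of _ "\<lambda>_. \<phi>"])

text \<open>Subtracting the approximants \<open>\<xi> n\<close> of \<open>u\<close> from the fixed
  \<open>\<phi>\<close> gives approximants of the difference. It is to this difference that Orlicz
  duality is applied in the limit passage.\<close>

lemma W12_0_gradient_test_function_diff:
  fixes u \<phi> :: "real^2 \<Rightarrow> real"
  assumes D: "D \<in> sets lebesgue" and \<phi>: "\<phi> \<in> test_functions D" and u: "W12_0_gradient D u g"
  shows "W12_0_gradient D (\<lambda>x. \<phi> x - u x) (\<lambda>x. grad \<phi> x - g x)"
proof -
  obtain \<xi> where \<xi>: "\<And>n. \<xi> n \<in> test_functions D"
    "(\<lambda>n. norm_L2 D (\<lambda>x. \<xi> n x - u x)) \<longlonglongrightarrow> 0" "(\<lambda>n. norm_L2 D (\<lambda>x. grad (\<xi> n) x - g x)) \<longlonglongrightarrow> 0"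
    using u by (auto simp: W12_0_gradient_def)
  have grad: "grad (\<lambda>x. \<phi> x - \<xi> n x) x = grad \<phi> x - grad (\<xi> n) x" for n x
    using \<phi> \<xi>(1) by (intro grad_diff) (auto intro: test_functions_differentiable)
  have "(\<lambda>n. norm_L2 D (\<lambda>x. \<phi> x - \<xi> n x - (\<phi> x - u x))) \<longlonglongrightarrow> 0"
    using \<xi>(2) by (simp add: norm_L2_minus_commute[of D _ u])
  moreover have "(\<lambda>n. norm_L2 D (\<lambda>x. grad (\<lambda>x. \<phi> x - \<xi> n x) x - (grad \<phi> x - g x))) \<longlonglongrightarrow> 0"
    using \<xi>(3) by (simp add: grad norm_L2_minus_commute[of D _ g])
  moreover have "\<forall>n. (\<lambda>x. \<phi> x - \<xi> n x) \<in> test_functions D"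
    using \<phi> \<xi>(1) test_functions_diff by blast
  ultimately show ?thesis
    using u square_integrable_test_function[OF D \<phi>] has_weak_gradient_test_function[OF D \<phi>]
    unfolding W12_0_gradient_def
    by (intro conjI exI[of _ "\<lambda>n x. \<phi> x - \<xi> n x"] square_integrable_diff has_weak_gradient_diff[OF D])
      simp_all
qed

text \<open>
  Integrating by parts twice makes the left-hand side independent of the choice of \<open>g\<close>, so that
  almost-everywhere uniqueness of weak gradients is never needed.
\<close>

lemma has_weak_gradient_pairing:
  fixes u \<psi> :: "real^2 \<Rightarrow> real"
  assumes D: "D \<in> sets lebesgue" and u: "has_weak_gradient D u g" and \<psi>: "\<psi> \<in> test_functions D"
  shows "(\<integral>x. (\<Sum>i\<in>UNIV. g x $ i * grad \<psi> x $ i) \<partial>lebesgue_on D)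
    = - (\<Sum>i\<in>UNIV. \<integral>x. u x * grad (\<lambda>x. grad \<psi> x $ i) x $ i \<partial>lebesgue_on D)"
proof -
  have "integrable (lebesgue_on D) (\<lambda>x. g x $ i * grad \<psi> x $ i)" for i
    using has_weak_gradient_integrable(2)[OF D u test_functions_partial[OF \<psi>]]
    by (simp add: mult.commute)
  then have "(\<integral>x. (\<Sum>i\<in>UNIV. g x $ i * grad \<psi> x $ i) \<partial>lebesgue_on D)
      = (\<Sum>i\<in>UNIV. \<integral>x. g x $ i * grad \<psi> x $ i \<partial>lebesgue_on D)"
    by (rule Bochner_Integration.integral_sum)
  also have "\<dots> = (\<Sum>i\<in>UNIV. - (\<integral>x. u x * grad (\<lambda>x. grad \<psi> x $ i) x $ i \<partial>lebesgue_on D))"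
    using u test_functions_partial[OF \<psi>] by (intro sum.cong) (auto simp: has_weak_gradient_def)
  finally show ?thesis
    by (simp add: sum_negf)
qed

subsection \<open>Consequences of the Moser--Trudinger inequality\<close>

lemma bounded_domain_sets_lebesgue: "bounded_domain D \<Longrightarrow> D \<in> sets lebesgue"
  by (simp add: bounded_domain_def borel_open)

text \<open>The Moser-Trudinger bound for Bochner integrals. The \<open>max 0\<close> appears
  because the sign of \<open>C\<^sub>2 * measure lebesgue D\<close> is not yet known and
  \<open>ennreal\<close> sends negative numbers to 0.\<close>

lemma Moser_Trudinger_integral:
  fixes u :: "real^2 \<Rightarrow> real"
  assumes D: "bounded_domain D" and C\<^sub>2: "Moser_Trudinger_constant C\<^sub>2"
    and u: "W12_0_gradient D u g" and nontriv: "nontrivial_on D u"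
  shows "integrable (lebesgue_on D) (\<lambda>x. exp (4 * pi * (\<bar>u x\<bar> / norm_L2 D g)\<^sup>2) - 1)"
    and "(\<integral>x. exp (4 * pi * (\<bar>u x\<bar> / norm_L2 D g)\<^sup>2) - 1 \<partial>lebesgue_on D)
      \<le> max 0 (C\<^sub>2 * measure lebesgue D)"
proof -
  let ?f = "\<lambda>x. exp (4 * pi * (\<bar>u x\<bar> / norm_L2 D g)\<^sup>2) - 1"
  have [measurable]: "u \<in> borel_measurable (lebesgue_on D)"
    using u by (simp add: W12_0_gradient_def square_integrable_def)
  have "u \<in> W12_0 D" "has_weak_gradient D u g"
    using u by (auto simp: W12_0_iff W12_0_gradient_def)
  then have le: "(\<integral>\<^sup>+ x. ennreal (?f x) \<partial>lebesgue_on D) \<le> ennreal (C\<^sub>2 * measure lebesgue D)"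
    using D C\<^sub>2 nontriv unfolding Moser_Trudinger_constant_def by blast
  show int: "integrable (lebesgue_on D) ?f"
    by (rule integrableI_nonneg) (use le in \<open>auto intro: le_less_trans\<close>)
  have "ennreal (integral\<^sup>L (lebesgue_on D) ?f) \<le> ennreal (max 0 (C\<^sub>2 * measure lebesgue D))"
    using le nn_integral_eq_integral[OF int] by (simp add: ennreal_max_0)
  then show "integral\<^sup>L (lebesgue_on D) ?f \<le> max 0 (C\<^sub>2 * measure lebesgue D)"
    by (subst (asm) ennreal_le_iff) auto
qed

text \<open>A continuous gradient that vanishes almost everywhere on the open set \<open>D\<close>
  vanishes on all of \<open>D\<close>, and outside \<open>D\<close> it is 0 by the support
  condition; then the function itself is 0. Without this, division by a norm equal to 0 would make
  the Moser-Trudinger integrand collapse to 0.\<close>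

lemma test_function_gradient_norm_pos:
  fixes \<phi> :: "real^2 \<Rightarrow> real"
  assumes D: "bounded_domain D" and \<phi>: "\<phi> \<in> test_functions D" and nontriv: "nontrivial_on D \<phi>"
  shows "norm_L2 D (grad \<phi>) > 0"
proof (rule ccontr)
  assume "\<not> norm_L2 D (grad \<phi>) > 0"
  then have zero: "norm_L2 D (grad \<phi>) = 0"
    using norm_L2_nonneg[of D "grad \<phi>"] by linarith
  have D': "D \<in> sets lebesgue" "open D"
    using D bounded_domain_sets_lebesgue by (auto simp: bounded_domain_def)
  have "AE x in lebesgue_on D. grad \<phi> x = 0"
    using square_integrable_test_function(2)[OF D'(1) \<phi>] zero by (rule norm_L2_eq_0)
  then have "AE x \<in> D in lebesgue. x \<in> {x. grad \<phi> x = 0}"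
    using D'(1) by (simp add: AE_restrict_space_iff)
  moreover have "closed {x. grad \<phi> x = 0}"
    using grad_continuous[OF \<phi>] by (intro closed_Collect_eq continuous_on_const)
  ultimately have "grad \<phi> x = 0" if "x \<in> D" for x
    using mem_closed_if_AE_lebesgue_open[OF \<open>open D\<close> _ _ that] by blast
  moreover have "grad \<phi> x = 0" if "x \<notin> D" for x
    using test_functions_support[OF \<phi>] that by (metis subsetD)
  ultimately have "\<phi> x = 0" for x
    using grad_eq_0_imp_eq_0[OF \<phi>] by blast
  with nontriv show False
    by (simp add: nontrivial_on_def)
qed

text \<open>Poincare's inequality falls out of Moser-Trudinger by keeping only the linear term,
  \<open>exp t - 1 \<ge> t\<close>.\<close>

lemma Poincare_test_function:
  fixes \<phi> :: "real^2 \<Rightarrow> real"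
  assumes D: "bounded_domain D" and C\<^sub>2: "Moser_Trudinger_constant C\<^sub>2" and \<phi>: "\<phi> \<in> test_functions D"
  shows "4 * pi * (norm_L2 D \<phi>)\<^sup>2 \<le> max 0 (C\<^sub>2 * measure lebesgue D) * (norm_L2 D (grad \<phi>))\<^sup>2"
proof (cases "nontrivial_on D \<phi>")
  case False
  then have "AE x in lebesgue_on D. (norm (\<phi> x))\<^sup>2 = 0"
    by (simp add: nontrivial_on_def)
  then have "norm_L2 D \<phi> = 0"
    by (simp add: norm_L2_def integral_eq_zero_AE)
  then show ?thesis
    by simp
next
  case True
  let ?G = "norm_L2 D (grad \<phi>)"
  have D': "D \<in> sets lebesgue"
    using D by (rule bounded_domain_sets_lebesgue)
  have G: "?G > 0"
    using test_function_gradient_norm_pos[OF D \<phi> True] .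
  note MT = Moser_Trudinger_integral[OF D C\<^sub>2 W12_0_gradient_test_function[OF D' \<phi>] True]
  have int: "integrable (lebesgue_on D) (\<lambda>x. (norm (\<phi> x))\<^sup>2)"
    using square_integrable_test_function(1)[OF D' \<phi>] by (simp add: square_integrable_def)
  have "4 * pi / ?G\<^sup>2 * (norm_L2 D \<phi>)\<^sup>2 = (\<integral>x. 4 * pi / ?G\<^sup>2 * (norm (\<phi> x))\<^sup>2 \<partial>lebesgue_on D)"
    by (simp add: norm_L2_square)
  also have "\<dots> \<le> (\<integral>x. exp (4 * pi * (\<bar>\<phi> x\<bar> / ?G)\<^sup>2) - 1 \<partial>lebesgue_on D)"
  proof (rule integral_mono)
    fix x
    have "4 * pi / ?G\<^sup>2 * (norm (\<phi> x))\<^sup>2 = 4 * pi * (\<bar>\<phi> x\<bar> / ?G)\<^sup>2"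
      by (simp add: power_divide)
    then show "4 * pi / ?G\<^sup>2 * (norm (\<phi> x))\<^sup>2 \<le> exp (4 * pi * (\<bar>\<phi> x\<bar> / ?G)\<^sup>2) - 1"
      using exp_ge_add_one_self[of "4 * pi * (\<bar>\<phi> x\<bar> / ?G)\<^sup>2"] by linarith
  qed (use int MT in auto)
  also note MT(2)
  finally show ?thesis
    using G by (simp add: field_simps)
qed

text \<open>If \<open>g\<close> had norm 0, the gradients of the approximants would tend to 0, hence
  so would the approximants by Poincare's inequality; yet they tend to \<open>u\<close>.\<close>

lemma W12_0_gradient_norm_pos:
  fixes u :: "real^2 \<Rightarrow> real"
  assumes D: "bounded_domain D" and C\<^sub>2: "Moser_Trudinger_constant C\<^sub>2"
    and u: "W12_0_gradient D u g" and nontriv: "nontrivial_on D u"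
  shows "norm_L2 D g > 0"
proof (rule ccontr)
  assume "\<not> norm_L2 D g > 0"
  then have "norm_L2 D g = 0"
    using norm_L2_nonneg[of D g] by linarith
  have D': "D \<in> sets lebesgue"
    using D by (rule bounded_domain_sets_lebesgue)
  have sq: "square_integrable D u" "square_integrable D g"
    using u by (auto simp: W12_0_gradient_def)
  obtain \<phi> where \<phi>: "\<And>n. \<phi> n \<in> test_functions D"
    "(\<lambda>n. norm_L2 D (\<lambda>x. \<phi> n x - u x)) \<longlonglongrightarrow> 0" "(\<lambda>n. norm_L2 D (\<lambda>x. grad (\<phi> n) x - g x)) \<longlonglongrightarrow> 0"
    using u by (auto simp: W12_0_gradient_def)
  note sq_\<phi> = square_integrable_test_function[OF D' \<phi>(1)]
  have "AE x in lebesgue_on D. g x = 0"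
    using sq(2) \<open>norm_L2 D g = 0\<close> by (rule norm_L2_eq_0)
  then have "norm_L2 D (\<lambda>x. grad (\<phi> n) x - g x) = norm_L2 D (grad (\<phi> n))" for n
    unfolding norm_L2_def using sq(2) sq_\<phi>(2)[of n]
    by (intro arg_cong[of _ _ sqrt] integral_cong_AE) (auto simp: square_integrable_def elim: eventually_mono)
  with \<phi>(3) have grad0: "(\<lambda>n. norm_L2 D (grad (\<phi> n))) \<longlonglongrightarrow> 0"
    by simp
  \<comment> \<open>The constant of Poincare's inequality for the squared norms.\<close>
  define K where "K = max 0 (C\<^sub>2 * measure lebesgue D) / (4 * pi)"
  have "K \<ge> 0"
    by (simp add: K_def)
  have "norm_L2 D (\<phi> n) \<le> sqrt K * norm_L2 D (grad (\<phi> n))" for n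
  proof (rule power2_le_imp_le)
    show "(norm_L2 D (\<phi> n))\<^sup>2 \<le> (sqrt K * norm_L2 D (grad (\<phi> n)))\<^sup>2"
      using Poincare_test_function[OF D C\<^sub>2 \<phi>(1), of n] \<open>K \<ge> 0\<close>
      by (simp add: power_mult_distrib K_def field_simps)
    show "0 \<le> sqrt K * norm_L2 D (grad (\<phi> n))"
      using \<open>K \<ge> 0\<close> by (simp add: norm_L2_nonneg)
  qed
  then have "norm_L2 D u * norm_L2 D (\<phi> n) \<le> norm_L2 D u * (sqrt K * norm_L2 D (grad (\<phi> n)))" for n
    using norm_L2_nonneg[of D u] by (rule mult_left_mono)
  then have "\<bar>\<integral>x. u x \<bullet> \<phi> n x \<partial>lebesgue_on D\<bar>
      \<le> norm_L2 D u * (sqrt K * norm_L2 D (grad (\<phi> n)))" for n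
    using Cauchy_Schwarz_L2[OF sq(1) sq_\<phi>(1)[of n]] by (rule order_trans[rotated])
  then have bound: "\<forall>\<^sub>F n in sequentially. norm (\<integral>x. u x \<bullet> \<phi> n x \<partial>lebesgue_on D)
      \<le> norm_L2 D u * (sqrt K * norm_L2 D (grad (\<phi> n)))"
    by simp
  have "(\<lambda>n. norm_L2 D u * (sqrt K * norm_L2 D (grad (\<phi> n)))) \<longlonglongrightarrow> 0"
    using tendsto_mult_left[OF tendsto_mult_left[OF grad0]] by simp
  with bound have "(\<lambda>n. \<integral>x. u x \<bullet> \<phi> n x \<partial>lebesgue_on D) \<longlonglongrightarrow> 0"
    by (rule Lim_null_comparison)
  \<comment> \<open>The pairings with \<open>u\<close> tend to 0 and also to the squared norm of
    \<open>u\<close>, which is therefore 0.\<close>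
  moreover have "(\<lambda>n. \<integral>x. u x \<bullet> \<phi> n x \<partial>lebesgue_on D) \<longlonglongrightarrow> (\<integral>x. u x \<bullet> u x \<partial>lebesgue_on D)"
    using sq(1) sq(1) sq_\<phi>(1) \<phi>(2) by (rule tendsto_integral_inner_L2)
  ultimately have "(\<integral>x. u x \<bullet> u x \<partial>lebesgue_on D) = 0"
    by (rule LIMSEQ_unique[symmetric])
  then have "norm_L2 D u = 0"
    by (simp add: norm_L2_def power2_eq_square)
  with nontriv show False
    using norm_L2_eq_0[OF sq(1)] by (simp add: nontrivial_on_def)
qed

text \<open>The sign is forced by the existence of a nontrivial \<open>u\<close>: otherwise the
  nonnegative Moser-Trudinger integrand would have integral 0, and \<open>u\<close> would vanish
  almost everywhere.\<close>

lemma Moser_Trudinger_constant_pos: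
  fixes u :: "real^2 \<Rightarrow> real"
  assumes D: "bounded_domain D" and C\<^sub>2: "Moser_Trudinger_constant C\<^sub>2"
    and u: "W12_0_gradient D u g" and nontriv: "nontrivial_on D u"
  shows "C\<^sub>2 * measure lebesgue D > 0"
proof (rule ccontr)
  assume "\<not> C\<^sub>2 * measure lebesgue D > 0"
  let ?f = "\<lambda>x. exp (4 * pi * (\<bar>u x\<bar> / norm_L2 D g)\<^sup>2) - 1"
  note MT = Moser_Trudinger_integral[OF D C\<^sub>2 u nontriv]
  have "integral\<^sup>L (lebesgue_on D) ?f \<le> 0"
    using MT(2) \<open>\<not> C\<^sub>2 * measure lebesgue D > 0\<close> by simp
  moreover have "integral\<^sup>L (lebesgue_on D) ?f \<ge> 0"
    by (rule integral_nonneg_AE) simp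
  ultimately have "AE x in lebesgue_on D. ?f x = 0"
    using integral_nonneg_eq_0_iff_AE[OF MT(1)] by simp
  then have "AE x in lebesgue_on D. u x = 0"
    using W12_0_gradient_norm_pos[OF D C\<^sub>2 u nontriv] by simp
  with nontriv show False
    by (simp add: nontrivial_on_def)
qed

subsection \<open>Orlicz duality\<close>

text \<open>On \<open>s \<ge> 0\<close>, \<open>N_fun\<close> is the Legendre conjugate of
  \<open>exp t - 1\<close> over \<open>t \<ge> 0\<close>: the supremum of
  \<open>s * t - (exp t - 1)\<close> is attained at \<open>t = ln s\<close> when
  \<open>s \<ge> 1\<close>, and at \<open>t = 0\<close> below that.\<close>

lemma Young_N_fun:
  fixes s t :: real
  assumes "s \<ge> 0" "t \<ge> 0"
  shows "s * t \<le> N_fun s + (exp t - 1)"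
proof (cases "s \<ge> 1")
  case False
  then have "s * t \<le> t"
    using assms by (simp add: mult_left_le_one_le)
  also have "t \<le> exp t - 1"
    using exp_ge_add_one_self[of t] by linarith
  finally show ?thesis
    using False by (simp add: N_fun_def)
next
  case True
  \<comment> \<open>The tangent to the exponential at \<open>ln s\<close>, the point of
    equality.\<close>
  have "s * (1 + (t - ln s)) \<le> s * exp (t - ln s)"
    using assms(1) exp_ge_add_one_self[of "t - ln s"] by (intro mult_left_mono) auto
  also have "\<dots> = exp t"
    using True by (simp add: exp_diff)
  finally show ?thesis
    using True by (simp add: N_fun_def algebra_simps)
qed

lemma N_fun_nonneg: "N_fun y \<ge> 0"
  using Young_N_fun[of y 0] by (cases "y \<ge> 0") (auto simp: N_fun_def)

lemma borel_measurable_N_fun [measurable]: "N_fun \<in> borel_measurable borel"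
  unfolding N_fun_def[abs_def] by measurable

text \<open>The L log L integrand dominates \<open>N_fun (y / l)\<close> at every scale
  \<open>l\<close>, so all the integrals under the infimum in \<open>norm_N\<close> are
  finite.\<close>

lemma N_fun_divide_le:
  assumes "y \<ge> 0" "l > 0"
  shows "N_fun (y / l) \<le> (1 + \<bar>ln l\<bar>) / l * (y * (1 + max 0 (ln y)))"
proof (cases "y / l \<ge> 1")
  case False
  then show ?thesis
    using assms by (simp add: N_fun_def)
next
  case True
  with assms have "y > 0"
    by (cases "y = 0") auto
  \<comment> \<open>The remainder \<open>1 - y / l\<close> is at most 0 in this case.\<close>
  have "N_fun (y / l) \<le> y / l * (ln y - ln l)"
    using True \<open>y > 0\<close> assms by (simp add: N_fun_def ln_div)
  also have "\<dots> \<le> y / l * ((1 + \<bar>ln l\<bar>) * (1 + max 0 (ln y)))"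
  proof (rule mult_left_mono)
    have "\<bar>ln l\<bar> * max 0 (ln y) \<ge> 0"
      by simp
    then show "ln y - ln l \<le> (1 + \<bar>ln l\<bar>) * (1 + max 0 (ln y))"
      by (simp only: distrib_left distrib_right)
  qed (use assms in simp)
  finally show ?thesis
    by (simp add: mult_ac)
qed

lemma L_log_L_integrable_N_fun:
  assumes V: "V \<in> L_log_L D" and "l > 0"
  shows "integrable (lebesgue_on D) (\<lambda>x. N_fun (\<bar>V x\<bar> / l))"
proof (rule Bochner_Integration.integrable_bound)
  have [measurable]: "V \<in> borel_measurable (lebesgue_on D)"
    using V by (simp add: L_log_L_def)
  have "integrable (lebesgue_on D) (\<lambda>x. \<bar>V x\<bar> * (1 + max 0 (ln \<bar>V x\<bar>)))"
    using V by (intro integrableI_nonneg) (auto simp: L_log_L_def)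
  then show "integrable (lebesgue_on D) (\<lambda>x. (1 + \<bar>ln l\<bar>) / l * (\<bar>V x\<bar> * (1 + max 0 (ln \<bar>V x\<bar>))))"
    by (rule integrable_mult_right)
  show "(\<lambda>x. N_fun (\<bar>V x\<bar> / l)) \<in> borel_measurable (lebesgue_on D)"
    by measurable
  show "AE x in lebesgue_on D. norm (N_fun (\<bar>V x\<bar> / l))
      \<le> norm ((1 + \<bar>ln l\<bar>) / l * (\<bar>V x\<bar> * (1 + max 0 (ln \<bar>V x\<bar>))))"
  proof (rule AE_I2)
    fix x
    show "norm (N_fun (\<bar>V x\<bar> / l)) \<le> norm ((1 + \<bar>ln l\<bar>) / l * (\<bar>V x\<bar> * (1 + max 0 (ln \<bar>V x\<bar>))))"
      using N_fun_divide_le[of "\<bar>V x\<bar>" l] N_fun_nonneg[of "\<bar>V x\<bar> / l"] \<open>l > 0\<close>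
      unfolding real_norm_def by linarith
  qed
qed

lemma L_log_L_positive_part:
  assumes V: "V \<in> L_log_L D"
  shows "(\<lambda>x. max (V x) 0) \<in> L_log_L D"
proof -
  have [measurable]: "V \<in> borel_measurable (lebesgue_on D)"
    using V by (simp add: L_log_L_def)
  have "\<bar>max (V x) 0\<bar> * (1 + max 0 (ln \<bar>max (V x) 0\<bar>)) \<le> \<bar>V x\<bar> * (1 + max 0 (ln \<bar>V x\<bar>))" for x
  proof (cases "V x \<ge> 0")
    case False
    then show ?thesis
      using mult_nonneg_nonneg[of "\<bar>V x\<bar>" "1 + max 0 (ln \<bar>V x\<bar>)"] by simp
  qed simp
  then have "(\<integral>\<^sup>+ x. ennreal (\<bar>max (V x) 0\<bar> * (1 + max 0 (ln \<bar>max (V x) 0\<bar>))) \<partial>lebesgue_on D)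
      \<le> (\<integral>\<^sup>+ x. ennreal (\<bar>V x\<bar> * (1 + max 0 (ln \<bar>V x\<bar>))) \<partial>lebesgue_on D)"
    by (intro nn_integral_mono ennreal_leI)
  then show ?thesis
    using V by (auto simp: L_log_L_def intro: le_less_trans)
qed

text \<open>Young's inequality with \<open>s = \<bar>W x\<bar>\<close> and the mixed exponent
  \<open>t = 4 * pi * \<bar>a x\<bar> * \<bar>b x\<bar> / (G * H)\<close>, where \<open>G\<close>
  and \<open>H\<close> are the gradient norms; Moser-Trudinger for \<open>a\<close> and for
  \<open>b\<close> bounds the exponential part. Two separate functions are allowed so that a small
  gradient norm of one of them makes the whole integral small.\<close>

lemma Orlicz_duality:
  fixes W a b :: "real^2 \<Rightarrow> real"
  assumes D: "bounded_domain D" and C\<^sub>2: "Moser_Trudinger_constant C\<^sub>2"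
    and a: "W12_0_gradient D a g" and b: "W12_0_gradient D b h"
    and W: "W \<in> borel_measurable (lebesgue_on D)" "integrable (lebesgue_on D) (\<lambda>x. N_fun \<bar>W x\<bar>)"
  shows "integrable (lebesgue_on D) (\<lambda>x. W x * a x * b x)" (is ?int)
    and "(\<integral>x. \<bar>W x * a x * b x\<bar> \<partial>lebesgue_on D) \<le> norm_L2 D g * norm_L2 D h / (4 * pi) *
      ((\<integral>x. N_fun \<bar>W x\<bar> \<partial>lebesgue_on D) + max 0 (C\<^sub>2 * measure lebesgue D))" (is ?le)
proof -
  note [measurable] = W(1)
  have [measurable]: "a \<in> borel_measurable (lebesgue_on D)" "b \<in> borel_measurable (lebesgue_on D)"
    using a b by (auto simp: W12_0_gradient_def square_integrable_def)
  have "?int \<and> ?le"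
  proof (cases "nontrivial_on D a \<and> nontrivial_on D b")
    \<comment> \<open>One factor vanishes almost everywhere, so the left-hand side is 0; dividing by
      its gradient norm would not be justified.\<close>
    case False
    then have zero: "AE x in lebesgue_on D. W x * a x * b x = 0"
      by (auto simp: nontrivial_on_def elim: eventually_mono)
    have "integrable (lebesgue_on D) (\<lambda>x. W x * a x * b x) \<longleftrightarrow> integrable (lebesgue_on D) (\<lambda>x. 0::real)"
      using zero by (intro integrable_cong_AE) auto
    moreover have "(\<integral>x. \<bar>W x * a x * b x\<bar> \<partial>lebesgue_on D) = 0"
      using zero by (intro integral_eq_zero_AE) auto
    moreover have "norm_L2 D g * norm_L2 D h / (4 * pi) *
        ((\<integral>x. N_fun \<bar>W x\<bar> \<partial>lebesgue_on D) + max 0 (C\<^sub>2 * measure lebesgue D)) \<ge> 0"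
      by (intro mult_nonneg_nonneg divide_nonneg_nonneg add_nonneg_nonneg integral_nonneg_AE)
        (auto simp: norm_L2_nonneg N_fun_nonneg)
    ultimately show ?thesis
      by simp
  next
    case True
    define G H where "G = norm_L2 D g" and "H = norm_L2 D h"
    define K where "K = max 0 (C\<^sub>2 * measure lebesgue D)"
    have pos: "G > 0" "H > 0"
      using W12_0_gradient_norm_pos[OF D C\<^sub>2] a b True by (auto simp: G_def H_def)
    define p q where "p = (\<lambda>x. exp (4 * pi * (\<bar>a x\<bar> / G)\<^sup>2) - 1)"
      and "q = (\<lambda>x. exp (4 * pi * (\<bar>b x\<bar> / H)\<^sup>2) - 1)"
    have p: "integrable (lebesgue_on D) p" "integral\<^sup>L (lebesgue_on D) p \<le> K"
      using Moser_Trudinger_integral[OF D C\<^sub>2 a] True by (auto simp: p_def G_def K_def)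
    have q: "integrable (lebesgue_on D) q" "integral\<^sup>L (lebesgue_on D) q \<le> K"
      using Moser_Trudinger_integral[OF D C\<^sub>2 b] True by (auto simp: q_def H_def K_def)
    let ?B = "\<lambda>x. N_fun \<bar>W x\<bar> + (p x + q x) / 2"
    have B_int: "integrable (lebesgue_on D) ?B"
      using W(2) p q by simp
    have bound: "4 * pi / (G * H) * \<bar>W x * a x * b x\<bar> \<le> ?B x" for x
    proof -
      define y z where "y = \<bar>a x\<bar> / G" and "z = \<bar>b x\<bar> / H"
      have nonneg: "y \<ge> 0" "z \<ge> 0"
        using pos by (auto simp: y_def z_def)
      \<comment> \<open>Two applications of \<open>2 * y * z \<le> y\<^sup>2 + z\<^sup>2\<close>,
        first in the exponent and then to the exponentials, reduce the mixed exponential to the pure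
        ones in \<open>p\<close> and \<open>q\<close>.\<close>
      have "4 * pi * (y * z) \<le> 4 * pi * ((y\<^sup>2 + z\<^sup>2) / 2)"
        using sum_squares_bound[of y z] by (intro mult_left_mono) auto
      then have "exp (4 * pi * (y * z)) \<le> exp (2 * pi * y\<^sup>2) * exp (2 * pi * z\<^sup>2)"
        by (simp add: exp_add[symmetric] algebra_simps)
      also have "\<dots> \<le> ((exp (2 * pi * y\<^sup>2))\<^sup>2 + (exp (2 * pi * z\<^sup>2))\<^sup>2) / 2"
        using sum_squares_bound[of "exp (2 * pi * y\<^sup>2)" "exp (2 * pi * z\<^sup>2)"] by simp
      also have "\<dots> = (p x + q x) / 2 + 1"
        by (simp add: p_def q_def y_def z_def exp_double[symmetric] mult.assoc field_simps)
      finally have exp: "exp (4 * pi * (y * z)) - 1 \<le> (p x + q x) / 2"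
        by linarith
      have "4 * pi / (G * H) * \<bar>W x * a x * b x\<bar> = \<bar>W x\<bar> * (4 * pi * (y * z))"
        using pos by (simp add: y_def z_def abs_mult)
      also have "\<dots> \<le> N_fun \<bar>W x\<bar> + (exp (4 * pi * (y * z)) - 1)"
        using nonneg by (intro Young_N_fun) auto
      finally show ?thesis
        using exp by linarith
    qed
    have scaled: "integrable (lebesgue_on D) (\<lambda>x. 4 * pi / (G * H) * \<bar>W x * a x * b x\<bar>)"
    proof (rule Bochner_Integration.integrable_bound[OF B_int])
      show "AE x in lebesgue_on D. norm (4 * pi / (G * H) * \<bar>W x * a x * b x\<bar>) \<le> norm (?B x)"
      proof (rule AE_I2)
        fix x
        have "4 * pi / (G * H) * \<bar>W x * a x * b x\<bar> \<ge> 0"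
          using pos by simp
        with bound[of x] show "norm (4 * pi / (G * H) * \<bar>W x * a x * b x\<bar>) \<le> norm (?B x)"
          unfolding real_norm_def by linarith
      qed
    qed measurable
    then have "integrable (lebesgue_on D) (\<lambda>x. G * H / (4 * pi) * (4 * pi / (G * H) * \<bar>W x * a x * b x\<bar>))"
      by (rule integrable_mult_right)
    then have "integrable (lebesgue_on D) (\<lambda>x. \<bar>W x * a x * b x\<bar>)"
      using pos by simp
    moreover have "(\<lambda>x. W x * a x * b x) \<in> borel_measurable (lebesgue_on D)"
      by measurable
    ultimately have ?int
      using integrable_abs_iff by blast
    have "4 * pi / (G * H) * (\<integral>x. \<bar>W x * a x * b x\<bar> \<partial>lebesgue_on D) \<le> integral\<^sup>L (lebesgue_on D) ?B"
      using integral_mono[OF scaled B_int bound] by simp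
    also have "\<dots> = (\<integral>x. N_fun \<bar>W x\<bar> \<partial>lebesgue_on D)
        + (integral\<^sup>L (lebesgue_on D) p + integral\<^sup>L (lebesgue_on D) q) / 2"
      using W(2) p q by simp
    also have "\<dots> \<le> (\<integral>x. N_fun \<bar>W x\<bar> \<partial>lebesgue_on D) + K"
      using p q by simp
    finally have "(\<integral>x. \<bar>W x * a x * b x\<bar> \<partial>lebesgue_on D)
        \<le> G * H / (4 * pi) * ((\<integral>x. N_fun \<bar>W x\<bar> \<partial>lebesgue_on D) + K)"
      using pos by (simp add: field_simps)
    with \<open>?int\<close> show ?thesis
      by (simp add: G_def H_def K_def)
  qed
  then show ?int ?le
    by auto
qed

text \<open>Duality at scale 1. It guarantees that the potential terms of the equation are genuine
  integrals.\<close>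

lemma L_log_L_integrable_mult:
  fixes a b :: "real^2 \<Rightarrow> real"
  assumes "bounded_domain D" "Moser_Trudinger_constant C\<^sub>2" "V \<in> L_log_L D"
    and "W12_0_gradient D a g" "W12_0_gradient D b h"
  shows "integrable (lebesgue_on D) (\<lambda>x. V x * a x * b x)"
  using assms L_log_L_integrable_N_fun[of V D 1]
  by (intro Orlicz_duality(1)[of D C\<^sub>2 a g b h]) (auto simp: L_log_L_def)

subsection \<open>The real-valued case\<close>

text \<open>The equation is tested with the approximants of \<open>u\<close>. Its gradient
  \<open>g'\<close> need not be the \<open>g\<close> that the approximating gradients converge to,
  so the two are exchanged before the limit is taken.\<close>

lemma energy_identity:
  fixes u :: "real^2 \<Rightarrow> real"
  assumes D: "bounded_domain D" and C\<^sub>2: "Moser_Trudinger_constant C\<^sub>2" and V: "V \<in> L_log_L D"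
    and u: "W12_0_gradient D u g" and g': "has_weak_gradient D u g'"
    and sol: "\<And>\<psi>. \<psi> \<in> test_functions D \<Longrightarrow>
      (\<integral>x. (\<Sum>i\<in>UNIV. g' x $ i * grad \<psi> x $ i) \<partial>lebesgue_on D)
        = (\<integral>x. (V x + E) * u x * \<psi> x \<partial>lebesgue_on D)"
  shows "(norm_L2 D g)\<^sup>2 = (\<integral>x. V x * u x * u x \<partial>lebesgue_on D) + E * (norm_L2 D u)\<^sup>2"
proof -
  have D': "D \<in> sets lebesgue"
    using D by (rule bounded_domain_sets_lebesgue)
  have sq: "square_integrable D u" "square_integrable D g" and wg: "has_weak_gradient D u g"
    using u by (auto simp: W12_0_gradient_def)
  obtain \<phi> where \<phi>: "\<And>n. \<phi> n \<in> test_functions D"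
    "(\<lambda>n. norm_L2 D (\<lambda>x. \<phi> n x - u x)) \<longlonglongrightarrow> 0" "(\<lambda>n. norm_L2 D (\<lambda>x. grad (\<phi> n) x - g x)) \<longlonglongrightarrow> 0"
    using u by (auto simp: W12_0_gradient_def)
  note sq_\<phi> = square_integrable_test_function[OF D' \<phi>(1)]
  have V\<phi>: "integrable (lebesgue_on D) (\<lambda>x. V x * u x * \<phi> n x)" for n
    using L_log_L_integrable_mult[OF D C\<^sub>2 V u W12_0_gradient_test_function[OF D' \<phi>(1)]] .
  have Vu: "integrable (lebesgue_on D) (\<lambda>x. V x * u x * u x)"
    using L_log_L_integrable_mult[OF D C\<^sub>2 V u u] .
  have eq: "(\<integral>x. g x \<bullet> grad (\<phi> n) x \<partial>lebesgue_on D)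
      = (\<integral>x. V x * u x * \<phi> n x \<partial>lebesgue_on D) + E * (\<integral>x. u x \<bullet> \<phi> n x \<partial>lebesgue_on D)" for n
  proof -
    have "(\<integral>x. g x \<bullet> grad (\<phi> n) x \<partial>lebesgue_on D)
        = (\<integral>x. (\<Sum>i\<in>UNIV. g x $ i * grad (\<phi> n) x $ i) \<partial>lebesgue_on D)"
      by (simp add: inner_vec_def)
    \<comment> \<open>Both pairings equal the same expression in \<open>u\<close> and second
      derivatives of the test function.\<close>
    also have "\<dots> = (\<integral>x. (\<Sum>i\<in>UNIV. g' x $ i * grad (\<phi> n) x $ i) \<partial>lebesgue_on D)"
      by (simp only: has_weak_gradient_pairing[OF D' wg \<phi>(1)] has_weak_gradient_pairing[OF D' g' \<phi>(1)])
    also have "\<dots> = (\<integral>x. (V x + E) * u x * \<phi> n x \<partial>lebesgue_on D)"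
      using \<phi>(1) by (rule sol)
    also have "\<dots> = (\<integral>x. V x * u x * \<phi> n x + E * (u x \<bullet> \<phi> n x) \<partial>lebesgue_on D)"
      by (simp add: algebra_simps)
    also have "\<dots> = (\<integral>x. V x * u x * \<phi> n x \<partial>lebesgue_on D) + E * (\<integral>x. u x \<bullet> \<phi> n x \<partial>lebesgue_on D)"
      using V\<phi> integrable_inner_L2[OF sq(1) sq_\<phi>(1)] by (simp del: inner_real_def)
    finally show ?thesis .
  qed
  have "(\<lambda>n. \<integral>x. V x * u x * \<phi> n x \<partial>lebesgue_on D) \<longlonglongrightarrow> (\<integral>x. V x * u x * u x \<partial>lebesgue_on D)"
  proof (rule LIM_zero_cancel, rule Lim_null_comparison)
    define K where "K = (\<integral>x. N_fun \<bar>V x\<bar> \<partial>lebesgue_on D) + max 0 (C\<^sub>2 * measure lebesgue D)"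
    show "\<forall>\<^sub>F n in sequentially.
        norm ((\<integral>x. V x * u x * \<phi> n x \<partial>lebesgue_on D) - (\<integral>x. V x * u x * u x \<partial>lebesgue_on D))
        \<le> norm_L2 D g * norm_L2 D (\<lambda>x. grad (\<phi> n) x - g x) / (4 * pi) * K"
    proof (rule always_eventually, rule allI)
      fix n
      have "norm ((\<integral>x. V x * u x * \<phi> n x \<partial>lebesgue_on D) - (\<integral>x. V x * u x * u x \<partial>lebesgue_on D))
          = norm (\<integral>x. V x * u x * (\<phi> n x - u x) \<partial>lebesgue_on D)"
        using V\<phi> Vu by (simp add: right_diff_distrib)
      also have "\<dots> \<le> (\<integral>x. \<bar>V x * u x * (\<phi> n x - u x)\<bar> \<partial>lebesgue_on D)"
        using integral_norm_bound[of "lebesgue_on D" "\<lambda>x. V x * u x * (\<phi> n x - u x)"] by simp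
      \<comment> \<open>Duality for \<open>u\<close> and \<open>\<phi> n - u\<close>: the gradient
        norm of the second factor tends to 0, while \<open>K\<close> stays fixed.\<close>
      also have "\<dots> \<le> norm_L2 D g * norm_L2 D (\<lambda>x. grad (\<phi> n) x - g x) / (4 * pi) * K"
        unfolding K_def using V L_log_L_integrable_N_fun[OF V, of 1]
        by (intro Orlicz_duality(2)[OF D C\<^sub>2 u W12_0_gradient_test_function_diff[OF D' \<phi>(1) u]])
          (auto simp: L_log_L_def)
      finally show "norm ((\<integral>x. V x * u x * \<phi> n x \<partial>lebesgue_on D) - (\<integral>x. V x * u x * u x \<partial>lebesgue_on D))
          \<le> norm_L2 D g * norm_L2 D (\<lambda>x. grad (\<phi> n) x - g x) / (4 * pi) * K" .
    qed
    have "(\<lambda>n. norm_L2 D g * norm_L2 D (\<lambda>x. grad (\<phi> n) x - g x) / (4 * pi) * K)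
        \<longlonglongrightarrow> norm_L2 D g * 0 / (4 * pi) * K"
      by (intro tendsto_intros \<phi>(3)) simp
    then show "(\<lambda>n. norm_L2 D g * norm_L2 D (\<lambda>x. grad (\<phi> n) x - g x) / (4 * pi) * K) \<longlonglongrightarrow> 0"
      by simp
  qed
  moreover have "(\<lambda>n. \<integral>x. u x \<bullet> \<phi> n x \<partial>lebesgue_on D) \<longlonglongrightarrow> (\<integral>x. u x \<bullet> u x \<partial>lebesgue_on D)"
    using sq(1) sq(1) sq_\<phi>(1) \<phi>(2) by (rule tendsto_integral_inner_L2)
  ultimately have "(\<lambda>n. \<integral>x. g x \<bullet> grad (\<phi> n) x \<partial>lebesgue_on D)
      \<longlonglongrightarrow> (\<integral>x. V x * u x * u x \<partial>lebesgue_on D) + E * (\<integral>x. u x \<bullet> u x \<partial>lebesgue_on D)"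
    unfolding eq by (intro tendsto_add tendsto_mult_left)
  moreover have "(\<lambda>n. \<integral>x. g x \<bullet> grad (\<phi> n) x \<partial>lebesgue_on D) \<longlonglongrightarrow> (\<integral>x. g x \<bullet> g x \<partial>lebesgue_on D)"
    using sq(2) sq(2) sq_\<phi>(2) \<phi>(3) by (rule tendsto_integral_inner_L2)
  ultimately have "(\<integral>x. g x \<bullet> g x \<partial>lebesgue_on D)
      = (\<integral>x. V x * u x * u x \<partial>lebesgue_on D) + E * (\<integral>x. u x \<bullet> u x \<partial>lebesgue_on D)"
    by (rule LIMSEQ_unique[rotated])
  then show ?thesis
    by (simp only: norm_L2_square power2_norm_eq_inner)
qed

lemma norm_N_lower_bound:
  fixes u :: "real^2 \<Rightarrow> real"
  assumes D: "bounded_domain D" and C\<^sub>2: "Moser_Trudinger_constant C\<^sub>2" and V: "V \<in> L_log_L D"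
    and "E \<le> 0" and u: "W12_0_gradient D u g" and nontriv: "nontrivial_on D u"
    and g': "has_weak_gradient D u g'"
    and sol: "\<And>\<psi>. \<psi> \<in> test_functions D \<Longrightarrow>
      (\<integral>x. (\<Sum>i\<in>UNIV. g' x $ i * grad \<psi> x $ i) \<partial>lebesgue_on D)
        = (\<integral>x. (V x + E) * u x * \<psi> x \<partial>lebesgue_on D)"
  shows "C\<^sub>2 * measure lebesgue D / (4 * pi) * norm_N C\<^sub>2 D (\<lambda>x. max (V x) 0) \<ge> 1"
proof -
  define c where "c = C\<^sub>2 * measure lebesgue D"
  have c: "c > 0"
    unfolding c_def by (rule Moser_Trudinger_constant_pos[OF D C\<^sub>2 u nontriv])
  have G: "norm_L2 D g > 0"
    by (rule W12_0_gradient_norm_pos[OF D C\<^sub>2 u nontriv])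
  let ?V = "\<lambda>x. max (V x) 0"
  have V': "?V \<in> L_log_L D"
    using V by (rule L_log_L_positive_part)
  have Vu: "integrable (lebesgue_on D) (\<lambda>x. V x * u x * u x)" "integrable (lebesgue_on D) (\<lambda>x. ?V x * u x * u x)"
    using L_log_L_integrable_mult[OF D C\<^sub>2 _ u u] V V' by auto
  \<comment> \<open>The term with \<open>E\<close> is nonpositive and is dropped.\<close>
  have "(norm_L2 D g)\<^sup>2 \<le> (\<integral>x. V x * u x * u x \<partial>lebesgue_on D)"
    using energy_identity[OF D C\<^sub>2 V u g' sol] mult_nonpos_nonneg[OF \<open>E \<le> 0\<close> zero_le_power2[of "norm_L2 D u"]]
    by linarith
  also have "\<dots> \<le> (\<integral>x. ?V x * u x * u x \<partial>lebesgue_on D)"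
  proof (rule integral_mono[OF Vu])
    show "V x * u x * u x \<le> ?V x * u x * u x" for x
      using mult_right_mono[of "V x" "?V x" "u x * u x"] by (simp add: mult.assoc)
  qed
  finally have G_le: "(norm_L2 D g)\<^sup>2 \<le> (\<integral>x. ?V x * u x * u x \<partial>lebesgue_on D)" .
  \<comment> \<open>A lower bound for each competitor in the infimum. It comes from duality with the
    rescaled potential \<open>?V x / l\<close> and with both functions equal to \<open>u\<close>, so
    that the squared gradient norm cancels.\<close>
  have lower: "4 * pi / c \<le> l + l / c * (\<integral>x. N_fun (\<bar>?V x\<bar> / l) \<partial>lebesgue_on D)" if "l > 0" for l
  proof -
    let ?I = "\<integral>x. N_fun (\<bar>?V x\<bar> / l) \<partial>lebesgue_on D"
    have W: "(\<lambda>x. ?V x / l) \<in> borel_measurable (lebesgue_on D)"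
      "integrable (lebesgue_on D) (\<lambda>x. N_fun \<bar>?V x / l\<bar>)"
      using V' L_log_L_integrable_N_fun[OF V' \<open>l > 0\<close>] \<open>l > 0\<close> by (auto simp: L_log_L_def)
    have "(\<integral>x. ?V x * u x * u x \<partial>lebesgue_on D) = l * (\<integral>x. \<bar>?V x / l * u x * u x\<bar> \<partial>lebesgue_on D)"
    proof -
      \<comment> \<open>The positive part and the square of \<open>u x\<close> are nonnegative, so
        the absolute value disappears.\<close>
      have "\<bar>?V x / l * u x * u x\<bar> = ?V x * u x * u x / l" for x
        using \<open>l > 0\<close> by (simp add: abs_mult mult.assoc flip: power2_eq_square)
      then show ?thesis
        using \<open>l > 0\<close> by simp
    qed
    also have "\<dots> \<le> l * (norm_L2 D g * norm_L2 D g / (4 * pi) * (?I + c))"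
      using Orlicz_duality(2)[OF D C\<^sub>2 u u W] c \<open>l > 0\<close> by (intro mult_left_mono) (auto simp: c_def)
    finally have "(norm_L2 D g)\<^sup>2 * 1 \<le> (norm_L2 D g)\<^sup>2 * (l / (4 * pi) * (?I + c))"
      using G_le by (simp add: power2_eq_square mult_ac)
    then have "1 \<le> l / (4 * pi) * (?I + c)"
      using G by (subst (asm) mult_le_cancel_left_pos) auto
    then show ?thesis
      using c by (simp add: field_simps)
  qed
  have "4 * pi / c \<le> norm_N C\<^sub>2 D ?V"
    unfolding norm_N_def c_def[symmetric] by (rule cINF_greatest) (use lower in auto)
  then show ?thesis
    using c by (simp add: c_def[symmetric] field_simps)
qed

subsection \<open>Reduction to real components\<close>

text \<open>Used for projections onto a real component, of the function and of its gradient, which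
  do not increase norms.\<close>

lemma square_integrable_contraction:
  fixes P :: "'a::euclidean_space \<Rightarrow> 'b::euclidean_space"
  assumes "bounded_linear P" "\<And>v. norm (P v) \<le> norm v" "square_integrable D f"
  shows "square_integrable D (\<lambda>x. P (f x))" "norm_L2 D (\<lambda>x. P (f x)) \<le> norm_L2 D f"
proof -
  have le: "(norm (P v))\<^sup>2 \<le> (norm v)\<^sup>2" for v
    using assms(2) by (intro power_mono) auto
  have f: "f \<in> borel_measurable (lebesgue_on D)" "integrable (lebesgue_on D) (\<lambda>x. (norm (f x))\<^sup>2)"
    using assms(3) by (auto simp: square_integrable_def)
  have P: "P \<in> borel_measurable borel"
    using assms(1) by (intro borel_measurable_continuous_onI linear_continuous_on)
  have Pf: "(\<lambda>x. P (f x)) \<in> borel_measurable (lebesgue_on D)"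
    using measurable_compose[OF f(1) P] .
  have int: "integrable (lebesgue_on D) (\<lambda>x. (norm (P (f x)))\<^sup>2)"
    by (rule Bochner_Integration.integrable_bound[OF f(2)]) (use Pf le in auto)
  with Pf show "square_integrable D (\<lambda>x. P (f x))"
    by (simp add: square_integrable_def)
  show "norm_L2 D (\<lambda>x. P (f x)) \<le> norm_L2 D f"
    unfolding norm_L2_def using integral_mono[OF int f(2)] le by simp
qed

text \<open>Applied to a gradient of \<open>u\<close>, this gives a gradient of the real function
  \<open>u x \<bullet> b\<close>.\<close>

definition vec_component :: "'a::real_inner \<Rightarrow> 'a^'n \<Rightarrow> real^'n" where
  "vec_component b v = (\<chi> i. v $ i \<bullet> b)"

lemma vec_component_nth [simp]: "vec_component b v $ i = v $ i \<bullet> b"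
  by (simp add: vec_component_def)

lemma bounded_linear_vec_component:
  fixes b :: "'a::euclidean_space"
  shows "bounded_linear (vec_component b :: 'a^'n \<Rightarrow> real^'n)"
  by (rule linear_conv_bounded_linear[THEN iffD1], rule linearI)
    (simp_all add: vec_eq_iff inner_add_left)

lemma norm_vec_component_le:
  assumes "norm b = 1"
  shows "norm (vec_component b v) \<le> norm v"
  unfolding norm_vec_def
proof (rule L2_set_mono)
  show "norm (vec_component b v $ i) \<le> norm (v $ i)" for i
    using Cauchy_Schwarz_ineq2[of "v $ i" b] assms by simp
qed simp

lemma has_weak_gradient_component:
  fixes u :: "real^2 \<Rightarrow> 'a::{real_normed_field, euclidean_space}"
  assumes D: "D \<in> sets lebesgue" and u: "has_weak_gradient D u g"
  shows "has_weak_gradient D (\<lambda>x. u x \<bullet> b) (\<lambda>x. vec_component b (g x))"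
  unfolding has_weak_gradient_def
proof (intro conjI ballI allI)
  show "locally_integrable D (\<lambda>x. u x \<bullet> b)"
    using u by (auto simp: has_weak_gradient_def locally_integrable_def)
  show "locally_integrable D (\<lambda>x. vec_component b (g x))"
    unfolding locally_integrable_def
  proof (intro allI impI)
    fix K :: "(real^2) set"
    assume "compact K \<and> K \<subseteq> D"
    then have "integrable (lebesgue_on K) g"
      using u by (simp add: has_weak_gradient_def locally_integrable_def)
    then show "integrable (lebesgue_on K) (\<lambda>x. vec_component b (g x))"
      by (rule integrable_bounded_linear[OF bounded_linear_vec_component])
  qed
next
  fix \<psi> :: "real^2 \<Rightarrow> real" and i :: 2
  assume \<psi>: "\<psi> \<in> test_functions D"
  \<comment> \<open>The weak gradient of \<open>u\<close> is tested with field-valued functions, so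
    the real test function is embedded by \<open>of_real\<close>. Field multiplication then becomes
    real scaling, which commutes with the inner product with \<open>b\<close>.\<close>
  let ?\<Psi> = "\<lambda>x. of_real (\<psi> x) :: 'a"
  have "grad ?\<Psi> x $ i = of_real (grad \<psi> x $ i)" for x
    using grad_bounded_linear(2)[OF bounded_linear_of_real test_functions_differentiable[OF \<psi>]] .
  moreover have "(\<integral>x. u x * grad ?\<Psi> x $ i \<partial>lebesgue_on D) = - (\<integral>x. g x $ i * ?\<Psi> x \<partial>lebesgue_on D)"
    using u test_functions_bounded_linear[OF bounded_linear_of_real \<psi>]
    unfolding has_weak_gradient_def by blast
  ultimately have "(\<integral>x. grad \<psi> x $ i *\<^sub>R u x \<partial>lebesgue_on D) = - (\<integral>x. \<psi> x *\<^sub>R g x $ i \<partial>lebesgue_on D)"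
    by (simp add: scaleR_conv_of_real mult.commute)
  then have "(\<integral>x. grad \<psi> x $ i *\<^sub>R u x \<partial>lebesgue_on D) \<bullet> b = - ((\<integral>x. \<psi> x *\<^sub>R g x $ i \<partial>lebesgue_on D) \<bullet> b)"
    by simp
  then show "(\<integral>x. u x \<bullet> b * grad \<psi> x $ i \<partial>lebesgue_on D)
      = - (\<integral>x. vec_component b (g x) $ i * \<psi> x \<partial>lebesgue_on D)"
    using has_weak_gradient_integrable(1)[OF D u test_functions_partial[OF \<psi>, of i]]
      has_weak_gradient_integrable(2)[OF D u \<psi>, of i]
    by (simp add: mult.commute flip: integral_inner_left)
qed

text \<open>Projection to a unit vector is a contraction, so the components of the approximants
  converge along with the approximants.\<close>

lemma W12_0_gradient_component:
  fixes u :: "real^2 \<Rightarrow> 'a::{real_normed_field, euclidean_space}"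
  assumes D: "D \<in> sets lebesgue" and u: "W12_0_gradient D u g" and b: "norm b = 1"
  shows "W12_0_gradient D (\<lambda>x. u x \<bullet> b) (\<lambda>x. vec_component b (g x))"
proof -
  have le: "norm (v \<bullet> b) \<le> norm v" for v
    using Cauchy_Schwarz_ineq2[of v b] b by simp
  note inner_b = square_integrable_contraction[OF bounded_linear_inner_left[of b] le]
  note comp_b = square_integrable_contraction[OF bounded_linear_vec_component[of b] norm_vec_component_le[OF b]]
  have sq: "square_integrable D u" "square_integrable D g"
    using u by (auto simp: W12_0_gradient_def)
  obtain \<phi> where \<phi>: "\<And>n. \<phi> n \<in> test_functions D"
    "(\<lambda>n. norm_L2 D (\<lambda>x. \<phi> n x - u x)) \<longlonglongrightarrow> 0" "(\<lambda>n. norm_L2 D (\<lambda>x. grad (\<phi> n) x - g x)) \<longlonglongrightarrow> 0"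
    using u by (auto simp: W12_0_gradient_def)
  note sq_\<phi> = square_integrable_test_function[OF D \<phi>(1)]
  have grad: "grad (\<lambda>x. \<phi> n x \<bullet> b) x = vec_component b (grad (\<phi> n) x)" for n x
    using grad_bounded_linear(2)[OF bounded_linear_inner_left test_functions_differentiable[OF \<phi>(1)]]
    by (simp add: vec_eq_iff)
  have "(\<lambda>n. norm_L2 D (\<lambda>x. \<phi> n x \<bullet> b - u x \<bullet> b)) \<longlonglongrightarrow> 0"
    using inner_b(2)[OF square_integrable_diff[OF sq_\<phi>(1) sq(1)]]
    by (intro Lim_null_comparison[OF always_eventually \<phi>(2)]) (simp add: norm_L2_nonneg inner_diff_left)
  moreover have "(\<lambda>n. norm_L2 D (\<lambda>x. grad (\<lambda>x. \<phi> n x \<bullet> b) x - vec_component b (g x))) \<longlonglongrightarrow> 0"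
    using comp_b(2)[OF square_integrable_diff[OF sq_\<phi>(2) sq(2)]]
    by (intro Lim_null_comparison[OF always_eventually \<phi>(3)])
      (simp add: grad norm_L2_nonneg linear_diff[OF bounded_linear.linear[OF bounded_linear_vec_component]])
  moreover have "\<forall>n. (\<lambda>x. \<phi> n x \<bullet> b) \<in> test_functions D"
    using test_functions_bounded_linear[OF bounded_linear_inner_left \<phi>(1)] by blast
  moreover have "has_weak_gradient D (\<lambda>x. u x \<bullet> b) (\<lambda>x. vec_component b (g x))"
    using u by (intro has_weak_gradient_component[OF D]) (simp add: W12_0_gradient_def)
  ultimately show ?thesis
    using inner_b(1)[OF sq(1)] comp_b(1)[OF sq(2)]
    unfolding W12_0_gradient_def by (intro conjI exI[of _ "\<lambda>n x. \<phi> n x \<bullet> b"]) simp_all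
qed

text \<open>\<open>V\<close> and \<open>E\<close> are real, so the equation decouples into its
  components. The inner product with \<open>b\<close> may be taken under the integral once both
  sides are known to be integrable.\<close>

lemma distributional_solution_component:
  fixes u :: "real^2 \<Rightarrow> 'a::{real_normed_field, euclidean_space}"
  assumes D: "bounded_domain D" and C\<^sub>2: "Moser_Trudinger_constant C\<^sub>2" and V: "V \<in> L_log_L D"
    and u: "W12_0_gradient D u g" and sol: "distributional_solution D V E u"
  shows "distributional_solution D V E (\<lambda>x. u x \<bullet> b)"
proof -
  have D': "D \<in> sets lebesgue"
    using D by (rule bounded_domain_sets_lebesgue)
  obtain g' where g': "has_weak_gradient D u g'" and eq: "\<And>\<Psi>. \<Psi> \<in> test_functions D \<Longrightarrow>
      (\<integral>x. (\<Sum>i\<in>UNIV. g' x $ i * grad \<Psi> x $ i) \<partial>lebesgue_on D)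
        = (\<integral>x. of_real (V x + E) * u x * \<Psi> x \<partial>lebesgue_on D)"
    using sol by (auto simp: distributional_solution_def)
  have "(\<integral>x. (\<Sum>i\<in>UNIV. vec_component b (g' x) $ i * grad \<psi> x $ i) \<partial>lebesgue_on D)
      = (\<integral>x. of_real (V x + E) * (u x \<bullet> b) * \<psi> x \<partial>lebesgue_on D)"
    if \<psi>: "\<psi> \<in> test_functions D" for \<psi>
  proof -
    let ?\<Psi> = "\<lambda>x. of_real (\<psi> x) :: 'a"
    have "grad ?\<Psi> x $ i = of_real (grad \<psi> x $ i)" for x i
      using grad_bounded_linear(2)[OF bounded_linear_of_real test_functions_differentiable[OF \<psi>]] .
    moreover have "?\<Psi> \<in> test_functions D"
      using bounded_linear_of_real \<psi> by (rule test_functions_bounded_linear)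
    ultimately have *: "(\<integral>x. (\<Sum>i\<in>UNIV. grad \<psi> x $ i *\<^sub>R g' x $ i) \<partial>lebesgue_on D)
        = (\<integral>x. ((V x + E) * \<psi> x) *\<^sub>R u x \<partial>lebesgue_on D)"
      using eq[of ?\<Psi>] by (simp add: scaleR_conv_of_real mult_ac)
    have int1: "integrable (lebesgue_on D) (\<lambda>x. \<Sum>i\<in>UNIV. grad \<psi> x $ i *\<^sub>R g' x $ i)"
      using has_weak_gradient_integrable(2)[OF D' g' test_functions_partial[OF \<psi>]]
      by (intro Bochner_Integration.integrable_sum)
    \<comment> \<open>Duality is available only for real-valued functions, so integrability is shown
      for each coordinate and reassembled over the basis.\<close>
    have "integrable (lebesgue_on D) (\<lambda>x. ((V x + E) * \<psi> x) * (u x \<bullet> e))" if "e \<in> Basis" for e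
    proof -
      have "norm e = 1"
        using that by simp
      note ue = W12_0_gradient_component[OF D' u this]
      have "integrable (lebesgue_on D) (\<lambda>x. V x * (u x \<bullet> e) * \<psi> x)"
        using L_log_L_integrable_mult[OF D C\<^sub>2 V ue W12_0_gradient_test_function[OF D' \<psi>]] .
      moreover have "integrable (lebesgue_on D) (\<lambda>x. (u x \<bullet> e) * \<psi> x)"
        using has_weak_gradient_integrable(1)[OF D' has_weak_gradient_component[OF D' g'] \<psi>, of e]
        by (simp add: mult.commute)
      ultimately have "integrable (lebesgue_on D) (\<lambda>x. V x * (u x \<bullet> e) * \<psi> x + E * ((u x \<bullet> e) * \<psi> x))"
        by simp
      then show ?thesis
        by (simp add: algebra_simps)
    qed
    then have "integrable (lebesgue_on D) (\<lambda>x. \<Sum>e\<in>Basis. (((V x + E) * \<psi> x) * (u x \<bullet> e)) *\<^sub>R e)"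
      by (intro Bochner_Integration.integrable_sum integrable_scaleR_left)
    moreover have "(\<Sum>e\<in>Basis. (((V x + E) * \<psi> x) * (u x \<bullet> e)) *\<^sub>R e) = ((V x + E) * \<psi> x) *\<^sub>R u x" for x
      by (simp add: euclidean_representation flip: scaleR_scaleR scaleR_sum_right)
    ultimately have int2: "integrable (lebesgue_on D) (\<lambda>x. ((V x + E) * \<psi> x) *\<^sub>R u x)"
      by simp
    have "(\<integral>x. (\<Sum>i\<in>UNIV. grad \<psi> x $ i *\<^sub>R g' x $ i) \<bullet> b \<partial>lebesgue_on D)
        = (\<integral>x. ((V x + E) * \<psi> x) *\<^sub>R u x \<bullet> b \<partial>lebesgue_on D)"
      using int1 int2 * by (subst (1 2) integral_inner_left) auto
    then show ?thesis
      by (simp add: inner_sum_left mult_ac)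
  qed
  with has_weak_gradient_component[OF D' g', of b] show ?thesis
    unfolding distributional_solution_def by blast
qed

theorem corollary1p5:
  fixes D :: "(real^2) set" and V :: "real^2 \<Rightarrow> real" and E C\<^sub>2 :: real
    and u :: "real^2 \<Rightarrow> 'a::{real_normed_field, euclidean_space}"
  assumes "bounded_domain D"
    and "Moser_Trudinger_constant C\<^sub>2"
    and "V \<in> L_log_L D"
    and "E \<le> 0"
    and "u \<in> W12_0 D"
    and "nontrivial_on D u"
    and "distributional_solution D V E u"
  shows "C\<^sub>2 * measure lebesgue D / (4 * pi) * norm_N C\<^sub>2 D (\<lambda>x. max (V x) 0) \<ge> 1"
proof -
  have D: "D \<in> sets lebesgue"
    using assms(1) by (rule bounded_domain_sets_lebesgue)
  obtain g where u: "W12_0_gradient D u g"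
    using assms(5) by (auto simp: W12_0_iff)
  \<comment> \<open>There are finitely many coordinates; if each vanished almost everywhere, so
    would \<open>u\<close>.\<close>
  have "\<exists>b\<in>Basis. nontrivial_on D (\<lambda>x. u x \<bullet> b)"
  proof (rule ccontr)
    assume "\<not> ?thesis"
    then have "AE x in lebesgue_on D. \<forall>b\<in>Basis. u x \<bullet> b = 0"
      by (intro AE_finite_allI) (auto simp: nontrivial_on_def)
    then have "AE x in lebesgue_on D. u x = 0"
      by (simp add: euclidean_all_zero_iff)
    with assms(6) show False
      by (simp add: nontrivial_on_def)
  qed
  then obtain b where b: "b \<in> Basis" "nontrivial_on D (\<lambda>x. u x \<bullet> b)"
    by blast
  have "norm b = 1"
    using b(1) by simp
  note ub = W12_0_gradient_component[OF D u this]
  obtain g' where g': "has_weak_gradient D (\<lambda>x. u x \<bullet> b) g'"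
    and eq: "\<And>\<psi>. \<psi> \<in> test_functions D \<Longrightarrow>
      (\<integral>x. (\<Sum>i\<in>UNIV. g' x $ i * grad \<psi> x $ i) \<partial>lebesgue_on D)
        = (\<integral>x. (V x + E) * (u x \<bullet> b) * \<psi> x \<partial>lebesgue_on D)"
    using distributional_solution_component[OF assms(1-3) u assms(7), of b]
    by (auto simp: distributional_solution_def)
  show ?thesis
    using assms(1-4) ub b(2) g' eq by (rule norm_N_lower_bound)
qed

end
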